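(* Let $\sigma\in(\tfrac12,1)$ be fixed. Then there is a positive constant $C_4(\sigma)$, which can be effectively computed, such that for all sufficiently large primes $q$, \[ \max_{\substack{\chi\ne\chi_0\\ \chi\ (\mathrm{mod}\ q)}}\ -\mathrm{Re}\,\frac{L'}{L}(\sigma,\chi)\ \ge\ C_4(\sigma)\,(\log q)^{1-\sigma}(\log\log q)^{1-\sigma}. \]
   Context: $L(s,\chi)$ denotes the Dirichlet $L$-function of a Dirichlet character $\chi$ modulo $q$; $\chi_0$ is the principal character mod $q$; the maximum is over non-principal characters mod $q$. *)

theory Defs
  imports "HOL-Analysis.Analysis" "HOL-Computational_Algebra.Primes"
begin

definition dirichlet_char :: "nat \<Rightarrow> (nat \<Rightarrow> complex) \<Rightarrow> bool" where
  "dirichlet_char q chi \<longleftrightarrow>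
     (\<forall>m n. chi (m * n) = chi m * chi n) \<and>
     (\<forall>n. chi (n + q) = chi n) \<and>
     (\<forall>n. chi n \<noteq> 0 \<longleftrightarrow> coprime n q)"

definition principal_char :: "nat \<Rightarrow> nat \<Rightarrow> complex" where
  "principal_char q n = (if coprime n q then 1 else 0)"

definition nonprincipal_chars :: "nat \<Rightarrow> (nat \<Rightarrow> complex) set" where
  "nonprincipal_chars q = {chi. dirichlet_char q chi \<and> chi \<noteq> principal_char q}"

text \<open>
  For a non-principal character the series below, summed in the natural order, converges for
  \<open>Re s > 0\<close> and is the L-function there. Outside that half-plane (and, for the principal
  character, for \<open>Re s \<le> 1\<close>) the value is meaningless.
\<close>

definition dirichlet_L :: "(nat \<Rightarrow> complex) \<Rightarrow> complex \<Rightarrow> complex" where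
  "dirichlet_L chi s = (\<Sum>n. chi (Suc n) / of_nat (Suc n) powr s)"

text \<open>
  Where \<open>dirichlet_L chi s = 0\<close> this is \<open>0\<close>, by the convention for division; such a value cannot
  attain a positive lower bound.
\<close>

definition log_deriv_L :: "(nat \<Rightarrow> complex) \<Rightarrow> complex \<Rightarrow> complex" where
  "log_deriv_L chi s = deriv (dirichlet_L chi) s / dirichlet_L chi s"

text \<open>
  Total recursive functions of \<open>n\<close> arguments, given as functions on lists of which only the
  values on lists of length \<open>n\<close> matter (rule \<open>cong\<close>). Minimization is restricted to
  regular functions, so that every function generated is total.
\<close>

inductive recursive :: "nat \<Rightarrow> (nat list \<Rightarrow> nat) \<Rightarrow> bool" where
  zero: "recursive n (\<lambda>_. 0)"
| succ: "recursive 1 (\<lambda>xs. Suc (xs ! 0))"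
| proj: "i < n \<Longrightarrow> recursive n (\<lambda>xs. xs ! i)"
| comp: "recursive (length gs) f \<Longrightarrow> \<forall>g\<in>set gs. recursive n g \<Longrightarrow>
         recursive n (\<lambda>xs. f (map (\<lambda>g. g xs) gs))"
| prim_rec: "recursive n f \<Longrightarrow> recursive (n + 2) g \<Longrightarrow>
         recursive (Suc n) (\<lambda>xs. rec_nat (f (tl xs)) (\<lambda>k r. g (k # r # tl xs)) (hd xs))"
| minimize: "recursive (Suc n) f \<Longrightarrow> \<forall>xs. length xs = n \<longrightarrow> (\<exists>k. f (k # xs) = 0) \<Longrightarrow>
         recursive n (\<lambda>xs. LEAST k. f (k # xs) = 0)"
| cong: "recursive n f \<Longrightarrow> \<forall>xs. length xs = n \<longrightarrow> g xs = f xs \<Longrightarrow> recursive n g"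

text \<open>
  Computability, in the sense of computable analysis, of a nonnegative real function on the open
  interval \<open>(1/2, 1)\<close>: on the compact subinterval with index \<open>k\<close>, a dyadic approximation of the
  argument within \<open>2^-d\<close>, where \<open>d\<close> is computed from \<open>k\<close> and \<open>n\<close>, is turned into a dyadic
  approximation of the value within \<open>2^-n\<close>.
\<close>

definition effectively_computable :: "(real \<Rightarrow> real) \<Rightarrow> bool" where
  "effectively_computable C \<longleftrightarrow>
     (\<exists>d g. recursive 2 d \<and> recursive 3 g \<and>
        (\<forall>k n i. \<forall>x\<in>{1 / 2 + 1 / 2 ^ k .. 1 - 1 / 2 ^ k}.
           \<bar>x - real i / 2 ^ d [k, n]\<bar> \<le> 1 / 2 ^ d [k, n] \<longrightarrow>
           \<bar>C x - real (g [k, n, i]) / 2 ^ n\<bar> \<le> 1 / 2 ^ n))"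

end

theory Submission
  imports Defs "HOL-Number_Theory.Number_Theory" "HOL-Complex_Analysis.Complex_Analysis"
    "HOL-Real_Asymp.Real_Asymp" "HOL-Computational_Algebra.Squarefree"
begin

text \<open>
  Write \<open>P\<close> for the sum of \<open>\<Lambda>(n) \<chi>(n) n powr -\<sigma>\<close> and \<open>M\<close> for the sum of \<open>\<mu>(n) \<chi>(n) n powr -\<sigma>\<close> over \<open>n \<le> y\<close>, where
  \<open>y\<close> is a small power of \<open>q\<close>. The Dirichlet series of \<open>L M - 1\<close> and \<open>L' + P L\<close> have no terms with \<open>n \<le> y\<close>,
  so by orthogonality their mean squares over \<open>\<chi> \<noteq> \<chi>\<^sub>0\<close> save a power of \<open>q\<close>; the tails of \<open>L\<close> and \<open>L'\<close> beyond
  a point slightly below \<open>q\<close> are small in mean square because the sums of \<open>\<chi>\<close> over intervals are at most \<open>q\<close> in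
  \<open>\<ell>\<^sup>2\<close>-norm. Hence \<open>L'/L = - P + O(1)\<close> at \<open>\<sigma>\<close>, for all but \<open>O(q powr (1 - \<eta>))\<close> characters, and no
  information on zeros is needed.

  By the pigeonhole principle there is a set \<open>B\<close> of at least \<open>(q - 1) / 8\<^sup>J\<close> characters whose quotients all satisfy
  \<open>Re \<chi>(p) \<ge> 1/2\<close> at \<open>J = c log q\<close> prescribed primes, which by Chebyshev can be taken of size
  \<open>O(log q log log q)\<close>. The average of \<open>\<chi>(n)\<close> over all quotients of elements of \<open>B\<close> is a square divided by
  \<open>|B|\<^sup>2\<close>, hence nonnegative for every \<open>n\<close>, so the average of \<open>Re P\<close> is at least half the sum of
  \<open>log p / p powr \<sigma>\<close> over the prescribed primes. For small \<open>c\<close> the set \<open>B\<close> is so large that the exceptional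
  characters do not affect this average.
\<close>

subsection \<open>Dirichlet characters modulo a prime\<close>

lemma dirichlet_char_mult: "dirichlet_char q chi \<Longrightarrow> chi (m * n) = chi m * chi n"
  by (simp add: dirichlet_char_def)

lemma dirichlet_char_eq_0_iff: "dirichlet_char q chi \<Longrightarrow> chi n = 0 \<longleftrightarrow> \<not> coprime n q"
  by (auto simp: dirichlet_char_def)

lemma dirichlet_char_Suc_0 [simp]:
  assumes "dirichlet_char q chi"
  shows   "chi (Suc 0) = 1"
proof -
  have "chi 1 * chi 1 = chi 1"
    using dirichlet_char_mult[OF assms, of 1 1] by simp
  moreover have "chi 1 \<noteq> 0"
    by (simp add: dirichlet_char_eq_0_iff[OF assms])
  ultimately show ?thesis by simp
qed

lemma dirichlet_char_power:
  assumes "dirichlet_char q chi"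
  shows   "chi (n ^ k) = chi n ^ k"
  by (induction k) (use assms in \<open>auto simp: dirichlet_char_mult\<close>)

lemma dirichlet_char_mod:
  assumes "dirichlet_char q chi"
  shows   "chi (n mod q) = chi n"
proof -
  have "chi (n mod q + k * q) = chi (n mod q)" for k
  proof (induction k)
    case (Suc k)
    have "chi (n mod q + k * q + q) = chi (n mod q + k * q)"
      using assms unfolding dirichlet_char_def by blast
    thus ?case using Suc by (simp add: algebra_simps)
  qed auto
  from this[of "n div q"] show ?thesis by simp
qed

lemma dirichlet_char_cong:
  assumes "dirichlet_char q chi" "[m = n] (mod q)"
  shows   "chi m = chi n"
  using dirichlet_char_mod[OF assms(1), of m] dirichlet_char_mod[OF assms(1), of n] assms(2)
  by (simp add: cong_def)

lemma dirichlet_char_cong_power: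
  assumes "dirichlet_char q chi" "[g ^ i = n] (mod q)"
  shows   "chi n = chi g ^ i"
  using dirichlet_char_cong[OF assms] dirichlet_char_power[OF assms(1)] by simp

text \<open>By Euler's theorem the value is a root of unity.\<close>

lemma norm_dirichlet_char:
  assumes "dirichlet_char q chi" "coprime n q" "q > 0"
  shows   "norm (chi n) = 1"
proof -
  have "chi (n ^ totient q) = 1"
    using dirichlet_char_cong[OF assms(1) euler_theorem[of n q]] assms by simp
  hence "norm (chi n) ^ totient q = 1"
    using assms(1) by (metis dirichlet_char_power norm_one norm_power)
  thus ?thesis
    using assms(3) power_eq_imp_eq_base[of "norm (chi n)" "totient q" 1] by simp
qed

lemma norm_dirichlet_char_le:
  assumes "dirichlet_char q chi" "q > 0"
  shows   "norm (chi n) \<le> 1"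
  using norm_dirichlet_char[OF assms(1) _ assms(2), of n] dirichlet_char_eq_0_iff[OF assms(1), of n]
  by (cases "coprime n q") auto

text \<open>For \<open>q > 0\<close> the nonzero values have norm 1, so this is the quotient of the
  two characters. The final averaging runs over such quotients.\<close>

lemma dirichlet_char_mult_cnj:
  assumes "dirichlet_char q chi" "dirichlet_char q psi"
  shows   "dirichlet_char q (\<lambda>n. chi n * cnj (psi n))"
  using assms unfolding dirichlet_char_def by (auto simp: algebra_simps)

lemma dirichlet_char_principal_char: "dirichlet_char q (principal_char q)"
proof -
  have "coprime (n + q) q \<longleftrightarrow> coprime n q" for n
    unfolding coprime_iff_gcd_eq_1 by simp
  thus ?thesis by (simp add: dirichlet_char_def principal_char_def)
qed

lemma nonprincipal_chars_subset: "nonprincipal_chars q \<subseteq> {chi. dirichlet_char q chi}"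
  by (auto simp: nonprincipal_chars_def)

text \<open>For \<open>i = j\<close> every term is 1. Otherwise multiplication by a primitive root
  of unity \<open>w\<close> permutes the roots and scales the sum by
  \<open>w ^ i * cnj w ^ j\<close>, which differs from 1 because \<open>i\<close> and
  \<open>j\<close> are below \<open>n\<close>.\<close>

lemma sum_roots_unity_powers:
  assumes "i < n" "j < n"
  shows   "(\<Sum>z | z ^ n = 1. z ^ i * cnj z ^ j) = (if i = j then of_nat n else (0::complex))"
proof (cases "i = j")
  case True
  have "n > 0" using assms by simp
  have "z ^ i * cnj z ^ j = 1" if "z ^ n = 1" for z :: complex
  proof -
    have "norm z ^ n = 1" using that by (metis norm_one norm_power)
    hence "norm z = 1"
      using \<open>n > 0\<close> power_eq_imp_eq_base[of "norm z" n 1] by simp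
    hence "z * cnj z = 1" by (simp add: complex_norm_square [symmetric])
    thus ?thesis using True by (simp flip: power_mult_distrib)
  qed
  hence "(\<Sum>z | z ^ n = 1. z ^ i * cnj z ^ j) = of_nat (card {z::complex. z ^ n = 1})"
    by simp
  thus ?thesis using True \<open>n > 0\<close> card_roots_unity_eq[of n] by simp
next
  case False
  have n: "n > 0" using assms by simp
  define w :: complex where "w = cis (2 * pi / n)"
  have w_pow: "w ^ k = cis (2 * pi * k / n)" for k
    unfolding w_def by (simp only: Complex.DeMoivre) (simp add: mult_ac)
  have wn: "w ^ n = 1" using n by (simp add: w_pow)
  have w_cnj: "w * cnj w = 1" by (simp add: w_def complex_norm_square [symmetric])
  have "inj_on (\<lambda>k. w ^ k) {..<n}"
    using bij_betw_imp_inj_on[OF Complex.bij_betw_roots_unity[OF n]] by (simp add: w_pow)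
  hence "w ^ i \<noteq> w ^ j" using False assms by (auto simp: inj_on_def)
  moreover have "w ^ i * cnj w ^ j * w ^ j = w ^ i * (w * cnj w) ^ j"
    by (simp add: power_mult_distrib)
  hence "w ^ i * cnj w ^ j * w ^ j = w ^ i"
    unfolding w_cnj by simp
  ultimately have neq: "w ^ i * cnj w ^ j \<noteq> 1" by (metis mult_1)
  have "(\<Sum>z | z ^ n = 1. z ^ i * cnj z ^ j) = (\<Sum>z | z ^ n = 1. (w * z) ^ i * cnj (w * z) ^ j)"
  proof (rule sum.reindex_bij_witness[of _ "\<lambda>z. w * z" "\<lambda>z. cnj w * z"])
    fix z :: complex
    show eq: "w * (cnj w * z) = z"
      unfolding mult.assoc [symmetric] w_cnj by simp
    thus "cnj w * (w * z) = z"
      by (simp add: mult_ac)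
    have "cnj w ^ n = 1" using wn by (metis complex_cnj_one complex_cnj_power)
    thus "cnj w * z \<in> {z. z ^ n = 1}" if "z \<in> {z. z ^ n = 1}"
      using that by (simp add: power_mult_distrib)
    show "w * z \<in> {z. z ^ n = 1}" if "z \<in> {z. z ^ n = 1}"
      using that wn by (simp add: power_mult_distrib)
    show "(w * (cnj w * z)) ^ i * cnj (w * (cnj w * z)) ^ j = z ^ i * cnj z ^ j"
      unfolding eq ..
  qed
  also have "\<dots> = w ^ i * cnj w ^ j * (\<Sum>z | z ^ n = 1. z ^ i * cnj z ^ j)"
    unfolding sum_distrib_left by (rule sum.cong) (simp_all add: power_mult_distrib)
  finally show ?thesis using neq False by simp
qed

section \<open>Characters modulo a prime, described through a primitive root\<close>

context
  fixes q :: nat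
  assumes prime_q: "prime q"
begin

lemma coprime_prime_modulus: "n > 0 \<Longrightarrow> n < q \<Longrightarrow> coprime n q"
  using prime_q by (metis coprime_commute nat_dvd_not_less prime_imp_coprime)

lemma primitive_root_obtain:
  obtains g where "coprime q g" "ord q g = q - 1" "\<And>n. coprime n q \<Longrightarrow> \<exists>i<q-1. [g ^ i = n] (mod q)"
proof -
  have "q \<in> cyclic_moduli"
  proof (cases "q = 2")
    case False
    hence "odd q" using prime_q prime_gt_1_nat[OF prime_q] by (simp add: prime_odd_nat)
    hence "q ^ 1 \<in> {p ^ k |p k. prime p \<and> odd p \<and> k > 0}"
      using prime_q by (intro CollectI exI[of _ q] exI[of _ 1]) simp
    thus ?thesis unfolding cyclic_moduli_def by simp
  next
    case True
    thus ?thesis unfolding cyclic_moduli_def by (intro UnI1) simp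
  qed
  then obtain g where g: "residue_primroot q g"
    using residue_primroot_iff_in_cyclic_moduli[of q] prime_gt_1_nat[OF prime_q] by auto
  have bij: "bij_betw (\<lambda>i. g ^ i mod q) {..<totient q} (totatives q)"
    using residue_primroot_is_generator[OF prime_gt_1_nat[OF prime_q] g] .
  show ?thesis
  proof
    show "coprime q g" "ord q g = q - 1"
      using g prime_q by (auto simp: residue_primroot_def totient_prime)
    fix n assume n: "coprime n q"
    have "coprime (n mod q) q"
      using n prime_gt_1_nat[OF prime_q] by simp
    moreover from this have "n mod q > 0"
      using prime_gt_1_nat[OF prime_q] by (intro Nat.gr0I) auto
    ultimately have "n mod q \<in> totatives q"
      using prime_gt_1_nat[OF prime_q] by (simp add: totatives_def less_imp_le)
    hence "n mod q \<in> (\<lambda>i. g ^ i mod q) ` {..<totient q}"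
      unfolding bij_betw_imp_surj_on[OF bij] .
    then obtain i where "i < totient q" "g ^ i mod q = n mod q"
      by (elim imageE) simp
    thus "\<exists>i<q-1. [g ^ i = n] (mod q)"
      using prime_q by (auto simp: cong_def totient_prime)
  qed
qed

text \<open>A character is determined by its value at the generator \<open>g\<close>, since it
  vanishes off the units. Conversely a root of unity \<open>z\<close> gives the character that sends
  \<open>n\<close> to \<open>z\<close> raised to the discrete logarithm of \<open>n\<close>.\<close>

lemma dirichlet_chars_bij_roots_unity:
  assumes g: "coprime q g" "ord q g = q - 1" "\<And>n. coprime n q \<Longrightarrow> \<exists>i<q-1. [g ^ i = n] (mod q)"
  shows "bij_betw (\<lambda>chi. chi g) {chi. dirichlet_char q chi} {z. z ^ (q - 1) = 1}"
proof (rule bij_betwI')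
  fix chi psi assume chi: "chi \<in> {chi. dirichlet_char q chi}" and psi: "psi \<in> {chi. dirichlet_char q chi}"
  have *: "chi n = psi n" if "chi g = psi g" for n
  proof (cases "coprime n q")
    case True
    then obtain i where i: "[g ^ i = n] (mod q)" using g(3) by blast
    have "chi n = chi g ^ i" "psi n = psi g ^ i"
      using chi psi i by (auto intro: dirichlet_char_cong_power)
    thus ?thesis using that by simp
  next
    case False
    thus ?thesis using chi psi dirichlet_char_eq_0_iff[of q chi n] dirichlet_char_eq_0_iff[of q psi n] by simp
  qed
  show "(chi g = psi g) = (chi = psi)"
    by (rule iffI, rule ext, erule *, erule arg_cong)
next
  fix chi assume chi: "chi \<in> {chi. dirichlet_char q chi}"
  have "[g ^ (q - 1) = 1] (mod q)"
    using ord[of g q] g(2) by simp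
  thus "chi g \<in> {z. z ^ (q - 1) = 1}"
    using dirichlet_char_cong_power[of q chi g "q - 1" 1] chi by simp
next
  fix z :: complex assume z: "z \<in> {z. z ^ (q - 1) = 1}"
  define ind where "ind n = (SOME i. i < q - 1 \<and> [g ^ i = n] (mod q))" for n
  have ind: "[g ^ ind n = n] (mod q)" if "coprime n q" for n
    using someI_ex[OF g(3)[OF that]] unfolding ind_def by blast
  \<comment> \<open>Discrete logarithms are determined only modulo \<open>q - 1\<close>; as
    \<open>z ^ (q - 1) = 1\<close>, the arbitrary choice in \<open>ind\<close> does not affect the
    powers of \<open>z\<close>.\<close>
  have z_cong: "z ^ d = z ^ e" if "[g ^ d = g ^ e] (mod q)" for d e
  proof -
    have "[d = e] (mod (q - 1))"
      using order_divides_expdiff[OF g(1)] that g(2) by simp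
    hence mod_eq: "d mod (q - 1) = e mod (q - 1)" unfolding cong_def .
    have "z ^ k = z ^ (k mod (q - 1))" for k
    proof -
      have "z ^ k = z ^ ((q - 1) * (k div (q - 1)) + k mod (q - 1))" by simp
      also have "\<dots> = z ^ (k mod (q - 1))"
        using z unfolding power_add power_mult by simp
      finally show ?thesis .
    qed
    from this[of d] this[of e] show ?thesis by (simp only: mod_eq)
  qed
  have nz: "z \<noteq> 0" using z prime_gt_1_nat[OF prime_q] by (auto simp: zero_power)
  define chi where "chi n = (if coprime n q then z ^ ind n else 0)" for n
  have "dirichlet_char q chi"
    unfolding dirichlet_char_def
  proof (intro conjI allI)
    fix m n
    show "chi (m * n) = chi m * chi n"
    proof (cases "coprime m q \<and> coprime n q")
      case True
      have "[g ^ ind (m * n) = m * n] (mod q)" using ind True by simp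
      moreover have "[g ^ (ind m + ind n) = m * n] (mod q)"
        unfolding power_add using ind True by (intro cong_mult) auto
      ultimately have "[g ^ ind (m * n) = g ^ (ind m + ind n)] (mod q)"
        unfolding cong_def by simp
      from z_cong[OF this] show ?thesis using True by (simp add: chi_def power_add)
    qed (auto simp: chi_def)
  next
    fix n
    have co_iff: "coprime (n + q) q \<longleftrightarrow> coprime n q"
      unfolding coprime_iff_gcd_eq_1 by simp
    show "chi (n + q) = chi n"
    proof (cases "coprime n q")
      case True
      hence co: "coprime (n + q) q" by (simp add: co_iff)
      have "[g ^ ind (n + q) = n + q] (mod q)" "[g ^ ind n = n] (mod q)" using ind True co by blast+
      moreover have "[n + q = n] (mod q)" by (simp add: cong_def)
      ultimately have "[g ^ ind (n + q) = g ^ ind n] (mod q)"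
        unfolding cong_def by simp
      from z_cong[OF this] show ?thesis using True co by (simp add: chi_def)
    qed (simp add: chi_def co_iff)
  next
    fix n show "(chi n \<noteq> 0) = coprime n q" using nz by (simp add: chi_def)
  qed
  moreover have "chi g = z"
  proof -
    have co: "coprime g q" using g(1) by (simp add: coprime_commute)
    hence "[g ^ ind g = g ^ 1] (mod q)" using ind by simp
    from z_cong[OF this] show ?thesis using co by (simp add: chi_def)
  qed
  ultimately show "\<exists>chi\<in>{chi. dirichlet_char q chi}. z = chi g" by auto
qed

lemma finite_dirichlet_chars: "finite {chi. dirichlet_char q chi}"
  and card_dirichlet_chars: "card {chi. dirichlet_char q chi} = q - 1"
proof -
  obtain g where g: "coprime q g" "ord q g = q - 1" "\<And>n. coprime n q \<Longrightarrow> \<exists>i<q-1. [g ^ i = n] (mod q)"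
    using primitive_root_obtain by metis
  note bij = dirichlet_chars_bij_roots_unity[OF g]
  have "finite {z::complex. z ^ (q - 1) = 1}" "card {z::complex. z ^ (q - 1) = 1} = q - 1"
    using prime_gt_1_nat[OF prime_q] finite_roots_unity[of "q - 1"] card_roots_unity_eq[of "q - 1"] by auto
  thus "finite {chi. dirichlet_char q chi}" "card {chi. dirichlet_char q chi} = q - 1"
    using bij_betw_finite[OF bij] bij_betw_same_card[OF bij] by auto
qed

lemma finite_nonprincipal_chars: "finite (nonprincipal_chars q)"
  using finite_subset[OF _ finite_dirichlet_chars] by (auto simp: nonprincipal_chars_def)

text \<open>Evaluation at a primitive root turns the sum into one over roots of unity. Within
  \<open>{1..<q}\<close> congruence modulo \<open>q\<close> is equality, so only the diagonal
  survives.\<close>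

lemma dirichlet_char_orthogonality:
  assumes "m \<in> {1..<q}" "n \<in> {1..<q}"
  shows "(\<Sum>chi | dirichlet_char q chi. chi m * cnj (chi n)) = (if m = n then of_nat (q - 1) else 0)"
proof -
  obtain g where g: "coprime q g" "ord q g = q - 1" "\<And>n. coprime n q \<Longrightarrow> \<exists>i<q-1. [g ^ i = n] (mod q)"
    using primitive_root_obtain by metis
  note bij = dirichlet_chars_bij_roots_unity[OF g]
  obtain i where i: "i < q - 1" "[g ^ i = m] (mod q)"
    using g(3)[of m] assms coprime_prime_modulus by auto
  obtain j where j: "j < q - 1" "[g ^ j = n] (mod q)"
    using g(3)[of n] assms coprime_prime_modulus by auto
  have "(\<Sum>chi | dirichlet_char q chi. chi m * cnj (chi n)) =
        (\<Sum>chi | dirichlet_char q chi. chi g ^ i * cnj (chi g) ^ j)"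
  proof (rule sum.cong)
    fix chi assume "chi \<in> {chi. dirichlet_char q chi}"
    hence "chi m = chi g ^ i" "chi n = chi g ^ j"
      using i j by (auto intro: dirichlet_char_cong_power)
    thus "chi m * cnj (chi n) = chi g ^ i * cnj (chi g) ^ j" by simp
  qed auto
  also have "\<dots> = (\<Sum>z | z ^ (q - 1) = 1. z ^ i * cnj z ^ j)"
    by (rule sum.reindex_bij_betw[OF bij])
  also have "\<dots> = (if i = j then of_nat (q - 1) else 0)"
    by (rule sum_roots_unity_powers) (use i j in auto)
  also have "i = j \<longleftrightarrow> m = n"
  proof
    assume "i = j"
    hence "[m = n] (mod q)" using i j unfolding cong_def by simp
    thus "m = n" using assms by (auto simp: cong_def)
  next
    assume "m = n"
    hence "[g ^ i = g ^ j] (mod q)" using i j unfolding cong_def by simp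
    hence "[i = j] (mod (q - 1))" using order_divides_expdiff[OF g(1)] g(2) by simp
    thus "i = j" using i j by (auto simp: cong_def)
  qed
  finally show ?thesis .
qed

text \<open>Some unit \<open>a\<close> has \<open>chi a \<noteq> 1\<close>, and multiplication by
  \<open>a\<close> permutes the residues, so the sum equals \<open>chi a\<close> times
  itself.\<close>

lemma sum_nonprincipal_char_eq_0:
  assumes "chi \<in> nonprincipal_chars q"
  shows   "(\<Sum>n<q. chi n) = 0"
proof -
  have chi: "dirichlet_char q chi" "chi \<noteq> principal_char q"
    using assms by (auto simp: nonprincipal_chars_def)
  have "\<exists>a. coprime a q \<and> chi a \<noteq> 1"
  proof (rule ccontr)
    assume "\<not> ?thesis"
    hence "chi = principal_char q"
      using dirichlet_char_eq_0_iff[OF chi(1)] by (auto simp: principal_char_def)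
    with chi(2) show False by blast
  qed
  then obtain a where a: "coprime a q" "chi a \<noteq> 1" by blast
  have inj: "inj_on (\<lambda>n. (a * n) mod q) {..<q}"
  proof (rule inj_onI)
    fix x y assume xy: "x \<in> {..<q}" "y \<in> {..<q}" "a * x mod q = a * y mod q"
    hence "[x = y] (mod q)" using cong_mult_lcancel_nat[OF a(1)] by (simp add: cong_def)
    thus "x = y" using xy by (simp add: cong_def)
  qed
  have "bij_betw (\<lambda>n. (a * n) mod q) {..<q} {..<q}"
    unfolding bij_betw_def using inj prime_gt_1_nat[OF prime_q] by (intro conjI endo_inj_surj) auto
  hence "(\<Sum>n<q. chi n) = (\<Sum>n<q. chi ((a * n) mod q))"
    by (rule sum.reindex_bij_betw [symmetric])
  also have "\<dots> = chi a * (\<Sum>n<q. chi n)"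
    by (simp add: dirichlet_char_mod[OF chi(1)] dirichlet_char_mult[OF chi(1)] sum_distrib_left)
  finally show ?thesis using a(2) by simp
qed

text \<open>Parseval: as \<open>A\<close> lies below \<open>q\<close>, orthogonality removes all
  off-diagonal terms of the expanded square.\<close>

lemma mean_square_char_sum:
  fixes b :: "nat \<Rightarrow> real"
  assumes A: "A \<subseteq> {1..<q}"
  shows "(\<Sum>chi | dirichlet_char q chi. (norm (\<Sum>n\<in>A. of_real (b n) * chi n))\<^sup>2) = real (q - 1) * (\<Sum>n\<in>A. (b n)\<^sup>2)"
proof -
  have fin: "finite A" using A finite_subset by blast
  have "complex_of_real (\<Sum>chi | dirichlet_char q chi. (norm (\<Sum>n\<in>A. of_real (b n) * chi n))\<^sup>2) =
    (\<Sum>chi | dirichlet_char q chi. (\<Sum>n\<in>A. of_real (b n) * chi n) * cnj (\<Sum>n\<in>A. of_real (b n) * chi n))"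
    unfolding of_real_sum by (intro sum.cong refl complex_norm_square)
  also have "\<dots> = (\<Sum>chi | dirichlet_char q chi. \<Sum>m\<in>A. \<Sum>n\<in>A. of_real (b m * b n) * (chi m * cnj (chi n)))"
    unfolding cnj_sum sum_product
    by (intro sum.cong refl) simp
  also have "\<dots> = (\<Sum>m\<in>A. \<Sum>chi | dirichlet_char q chi. \<Sum>n\<in>A. of_real (b m * b n) * (chi m * cnj (chi n)))"
    by (rule sum.swap)
  also have "\<dots> = (\<Sum>m\<in>A. \<Sum>n\<in>A. of_real (b m * b n) * (\<Sum>chi | dirichlet_char q chi. chi m * cnj (chi n)))"
    unfolding sum_distrib_left by (rule sum.cong[OF refl], rule sum.swap)
  also have "\<dots> = (\<Sum>m\<in>A. \<Sum>n\<in>A. if m = n then of_real (b m * b n) * of_nat (q - 1) else 0)"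
  proof (rule sum.cong[OF refl], rule sum.cong[OF refl])
    fix m n assume "m \<in> A" "n \<in> A"
    note mn = subsetD[OF A this(1)] subsetD[OF A this(2)]
    show "of_real (b m * b n) * (\<Sum>chi | dirichlet_char q chi. chi m * cnj (chi n)) =
            (if m = n then of_real (b m * b n) * of_nat (q - 1) else 0)"
      unfolding dirichlet_char_orthogonality[OF mn] by simp
  qed
  also have "\<dots> = (\<Sum>m\<in>A. of_real (b m * b m) * of_nat (q - 1))"
    using fin by simp
  also have "\<dots> = complex_of_real (real (q - 1) * (\<Sum>n\<in>A. (b n)\<^sup>2))"
    by (simp add: sum_distrib_left sum_distrib_right power2_eq_square mult.commute)
  finally show ?thesis by (simp only: of_real_eq_iff)
qed

end

subsection \<open>Character sums and tails in mean square\<close>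

text \<open>Minkowski's inequality, extended from two summands by induction.\<close>

lemma L2_set_norm_sum_le:
  fixes F :: "'a \<Rightarrow> 'b \<Rightarrow> 'c :: real_normed_vector"
  shows "L2_set (\<lambda>x. norm (\<Sum>k\<in>K. F k x)) A \<le> (\<Sum>k\<in>K. L2_set (\<lambda>x. norm (F k x)) A)"
proof (induction K rule: infinite_finite_induct)
  case (insert k K)
  have "L2_set (\<lambda>x. norm (\<Sum>k\<in>insert k K. F k x)) A \<le> L2_set (\<lambda>x. norm (F k x) + norm (\<Sum>k\<in>K. F k x)) A"
    using insert.hyps by (intro L2_set_mono) (auto simp: norm_triangle_ineq)
  also have "\<dots> \<le> L2_set (\<lambda>x. norm (F k x)) A + L2_set (\<lambda>x. norm (\<Sum>k\<in>K. F k x)) A"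
    by (rule L2_set_triangle_ineq)
  also have "\<dots> \<le> (\<Sum>k\<in>insert k K. L2_set (\<lambda>x. norm (F k x)) A)"
    using insert by simp
  finally show ?case .
qed (simp_all add: L2_set_def)

lemma L2_set_norm_mult:
  fixes f :: "'b \<Rightarrow> 'c :: real_normed_div_algebra"
  shows "L2_set (\<lambda>x. norm (c * f x)) A = norm c * L2_set (\<lambda>x. norm (f x)) A"
  by (simp add: norm_mult L2_set_right_distrib)

lemma L2_set_mono_set:
  assumes "A \<subseteq> B" "finite B"
  shows   "L2_set f A \<le> L2_set f B"
  unfolding L2_set_def by (intro real_sqrt_le_mono sum_mono2) (use assms in auto)

lemma abel_summation:
  fixes f :: "nat \<Rightarrow> 'a :: comm_ring" and c :: "nat \<Rightarrow> 'a"
  assumes "N \<le> M"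
  shows "(\<Sum>n\<in>{N<..M}. f n * c n) =
           f (Suc M) * (\<Sum>k\<in>{1..M}. c k) - f (Suc N) * (\<Sum>k\<in>{1..N}. c k)
           + (\<Sum>n\<in>{N<..M}. (f n - f (Suc n)) * (\<Sum>k\<in>{1..n}. c k))"
  using assms
proof (induction M rule: dec_induct)
  case (step M)
  have "{N<..Suc M} = insert (Suc M) {N<..M}" using step.hyps by auto
  thus ?case using step by (simp add: algebra_simps)
qed simp

context
  fixes q :: nat
  assumes prime_q: "prime q"
begin

text \<open>Complete periods cancel. This leaves fewer than \<open>q\<close> terms, the range in
  which Parseval applies.\<close>

lemma sum_nonprincipal_char_mod:
  assumes chi: "chi \<in> nonprincipal_chars q"
  shows   "(\<Sum>n\<in>{1..M}. chi n) = (\<Sum>n\<in>{1..M mod q}. chi n)"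
proof -
  have dc: "dirichlet_char q chi" using chi by (simp add: nonprincipal_chars_def)
  have per: "chi (n + q) = chi n" for n
    using dc unfolding dirichlet_char_def by blast
  have 0: "chi 0 = 0"
    using dirichlet_char_eq_0_iff[OF dc, of 0] prime_gt_1_nat[OF prime_q] by simp
  have shift: "(\<Sum>n<q + m. chi n) = (\<Sum>n<m. chi n)" for m
    by (induction m) (use sum_nonprincipal_char_eq_0[OF prime_q chi] per in \<open>simp_all add: add.commute\<close>)
  have "(\<Sum>n<k * q + m. chi n) = (\<Sum>n<m. chi n)" for k m
  proof (induction k)
    case (Suc k)
    have "(\<Sum>n<q + (k * q + m). chi n) = (\<Sum>n<m. chi n)" using shift Suc by simp
    thus ?case by (simp add: algebra_simps)
  qed simp
  from this[of "M div q" "Suc (M mod q)"]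
  have "(\<Sum>n<Suc M. chi n) = (\<Sum>n<Suc (M mod q). chi n)" by simp
  moreover have "(\<Sum>n<Suc m. chi n) = (\<Sum>n\<in>{1..m}. chi n)" for m
    unfolding lessThan_Suc_atMost atMost_atLeast0 by (subst sum.atLeast_Suc_atMost) (simp_all add: 0)
  ultimately show ?thesis by simp
qed

lemma norm_sum_nonprincipal_char_le:
  assumes chi: "chi \<in> nonprincipal_chars q"
  shows   "norm (\<Sum>n\<in>{1..M}. chi n) \<le> real q"
proof -
  have dc: "dirichlet_char q chi" using chi by (simp add: nonprincipal_chars_def)
  have "q > 0" using prime_gt_0_nat[OF prime_q] .
  have "norm (\<Sum>n\<in>{1..M mod q}. chi n) \<le> (\<Sum>n\<in>{1..M mod q}. 1)"
    by (intro sum_norm_le norm_dirichlet_char_le[OF dc \<open>q > 0\<close>])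
  also have "\<dots> \<le> real q" using \<open>q > 0\<close> by (simp add: less_imp_le)
  finally show ?thesis by (subst sum_nonprincipal_char_mod[OF chi])
qed

lemma L2_char_sum_le:
  assumes A: "A \<subseteq> {1..<q}" and X: "X \<subseteq> {chi. dirichlet_char q chi}"
  shows "L2_set (\<lambda>chi. norm (\<Sum>n\<in>A. of_real (b n) * chi n)) X \<le> sqrt (real q * (\<Sum>n\<in>A. (b n)\<^sup>2))"
proof -
  have "L2_set (\<lambda>chi. norm (\<Sum>n\<in>A. of_real (b n) * chi n)) X
        \<le> L2_set (\<lambda>chi. norm (\<Sum>n\<in>A. of_real (b n) * chi n)) {chi. dirichlet_char q chi}"
    using X by (intro L2_set_mono_set finite_dirichlet_chars[OF prime_q])
  also have "\<dots> = sqrt (real (q - 1) * (\<Sum>n\<in>A. (b n)\<^sup>2))"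
    unfolding L2_set_def mean_square_char_sum[OF prime_q A] ..
  also have "\<dots> \<le> sqrt (real q * (\<Sum>n\<in>A. (b n)\<^sup>2))"
    by (intro real_sqrt_le_mono mult_right_mono sum_nonneg) auto
  finally show ?thesis .
qed

text \<open>After reduction there are fewer than \<open>q\<close> terms with coefficient 1, so
  Parseval gives at most \<open>sqrt (q * q)\<close>, uniformly in \<open>M\<close>. Spread over
  about \<open>q\<close> characters this is square-root cancellation.\<close>

lemma L2_sum_nonprincipal_chars_le:
  "L2_set (\<lambda>chi. norm (\<Sum>n\<in>{1..M}. chi n)) (nonprincipal_chars q) \<le> real q"
proof -
  have q: "q > 0" using prime_gt_0_nat[OF prime_q] .
  have "L2_set (\<lambda>chi. norm (\<Sum>n\<in>{1..M}. chi n)) (nonprincipal_chars q) =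
        L2_set (\<lambda>chi. norm (\<Sum>n\<in>{1..M mod q}. of_real 1 * chi n)) (nonprincipal_chars q)"
    by (intro L2_set_cong refl) (subst sum_nonprincipal_char_mod, assumption, simp)
  also have "\<dots> \<le> sqrt (real q * (\<Sum>n\<in>{1..M mod q}. 1\<^sup>2))"
    using mod_less_divisor[OF q, of M]
    by (intro L2_char_sum_le nonprincipal_chars_subset prime_q) auto
  also have "\<dots> \<le> sqrt (real q * real q)"
    using mod_less_divisor[OF q, of M] by (intro real_sqrt_le_mono mult_left_mono) simp_all
  finally show ?thesis by simp
qed

text \<open>Abel summation expresses the tail through character sums starting at 1, each of norm at
  most \<open>q\<close> in mean square, and Minkowski's inequality adds them up. As \<open>M\<close>
  does not enter the bound, it passes to infinite tails.\<close>

lemma L2_nonprincipal_tail_le: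
  fixes f :: "nat \<Rightarrow> real"
  assumes "N \<le> M" and nonneg: "\<And>n. n > N \<Longrightarrow> f n \<ge> 0"
    and anti: "\<And>n. n > N \<Longrightarrow> f (Suc n) \<le> f n"
  shows "L2_set (\<lambda>chi. norm (\<Sum>n\<in>{N<..M}. of_real (f n) * chi n)) (nonprincipal_chars q)
           \<le> 2 * real q * f (Suc N)"
proof -
  let ?X = "nonprincipal_chars q"
  define S where "S M chi = (\<Sum>k\<in>{1..M}. chi k)" for M and chi :: "nat \<Rightarrow> complex"
  have S: "L2_set (\<lambda>chi. norm (c * S M chi)) ?X \<le> norm c * real q" for c M
    unfolding L2_set_norm_mult S_def by (intro mult_left_mono L2_sum_nonprincipal_chars_le) auto
  have "L2_set (\<lambda>chi. norm (\<Sum>n\<in>{N<..M}. of_real (f n) * chi n)) ?X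
    = L2_set (\<lambda>chi. norm (of_real (f (Suc M)) * S M chi - of_real (f (Suc N)) * S N chi
           + (\<Sum>n\<in>{N<..M}. (of_real (f n) - of_real (f (Suc n))) * S n chi))) ?X"
    unfolding S_def by (intro L2_set_cong refl arg_cong[of _ _ norm] abel_summation assms)
  also have "\<dots> \<le> L2_set (\<lambda>chi. norm (of_real (f (Suc M)) * S M chi) + norm (of_real (f (Suc N)) * S N chi)
           + norm (\<Sum>n\<in>{N<..M}. (of_real (f n) - of_real (f (Suc n))) * S n chi)) ?X"
    by (intro L2_set_mono order_trans[OF norm_triangle_ineq] add_right_mono norm_triangle_ineq4) auto
  also have "\<dots> \<le> L2_set (\<lambda>chi. norm (of_real (f (Suc M)) * S M chi)) ?X
           + L2_set (\<lambda>chi. norm (of_real (f (Suc N)) * S N chi)) ?X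
           + L2_set (\<lambda>chi. norm (\<Sum>n\<in>{N<..M}. (of_real (f n) - of_real (f (Suc n))) * S n chi)) ?X"
    by (intro order_trans[OF L2_set_triangle_ineq] add_right_mono L2_set_triangle_ineq)
  also have "L2_set (\<lambda>chi. norm (\<Sum>n\<in>{N<..M}. (of_real (f n) - of_real (f (Suc n))) * S n chi)) ?X
      \<le> (\<Sum>n\<in>{N<..M}. L2_set (\<lambda>chi. norm ((of_real (f n) - of_real (f (Suc n))) * S n chi)) ?X)"
    by (rule L2_set_norm_sum_le)
  also have "\<dots> \<le> (\<Sum>n\<in>{N<..M}. (f n - f (Suc n)) * real q)"
  proof (intro sum_mono)
    fix n assume n: "n \<in> {N<..M}"
    have "norm (complex_of_real (f n) - complex_of_real (f (Suc n))) = f n - f (Suc n)"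
      using anti[of n] n by (simp flip: of_real_diff)
    thus "L2_set (\<lambda>chi. norm ((of_real (f n) - of_real (f (Suc n))) * S n chi)) ?X \<le> (f n - f (Suc n)) * real q"
      using S[of "of_real (f n) - of_real (f (Suc n))" n] by simp
  qed
  \<comment> \<open>The differences telescope; with the two boundary terms the total weight is
    \<open>2 * f (Suc N)\<close>.\<close>
  also have "(\<Sum>n\<in>{N<..M}. (f n - f (Suc n)) * real q) = (f (Suc N) - f (Suc M)) * real q"
    using \<open>N \<le> M\<close>
  proof (induction M rule: dec_induct)
    case (step M)
    have "{N<..Suc M} = insert (Suc M) {N<..M}" using step.hyps by auto
    thus ?case using step by (simp add: algebra_simps)
  qed simp
  also have "L2_set (\<lambda>chi. norm (of_real (f (Suc M)) * S M chi)) ?X \<le> f (Suc M) * real q"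
    using S[of "of_real (f (Suc M))" M] nonneg[of "Suc M"] \<open>N \<le> M\<close> by simp
  also have "L2_set (\<lambda>chi. norm (of_real (f (Suc N)) * S N chi)) ?X \<le> f (Suc N) * real q"
    using S[of "of_real (f (Suc N))" N] nonneg[of "Suc N"] by simp
  finally show ?thesis by (simp add: algebra_simps)
qed

end

text \<open>Mean value inequality on the segment from \<open>n\<close> to \<open>n + 1\<close>. The
  extra factor \<open>1 / n\<close> makes the series obtained by Abel summation converge
  absolutely.\<close>

lemma norm_powr_diff_le:
  assumes "Re s > 0" "n > 0"
  shows "norm (of_nat n powr (-s) - of_nat (Suc n) powr (-s)) \<le> norm s * real n powr (- Re s - 1)"
proof -
  let ?S = "closed_segment (complex_of_real n) (complex_of_real (n + 1))"
  have seg: "?S = of_real ` {real n..real (n + 1)}"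
    using closed_segment_of_real[of "real n" "real (n + 1)"]
    by (simp add: closed_segment_eq_real_ivl)
  have "norm (complex_of_real n powr (-s) - complex_of_real (n + 1) powr (-s))
      \<le> norm s * real n powr (- Re s - 1) * norm (complex_of_real n - complex_of_real (n + 1))"
  proof (rule field_differentiable_bound[where S = ?S and f' = "\<lambda>z. -s * z powr (-s - 1)"])
    fix z assume "z \<in> ?S"
    then obtain t where t: "z = of_real t" "t \<ge> real n" unfolding seg by auto
    have tpos: "t > 0" using t assms by simp
    hence "z \<notin> \<real>\<^sub>\<le>\<^sub>0" using t by simp
    thus "((\<lambda>z. z powr - s) has_field_derivative - s * z powr (- s - 1)) (at z within ?S)"
      by (auto intro!: derivative_eq_intros)
    have "norm (z powr (- s - 1)) = t powr (- Re s - 1)"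
      using t tpos by (simp add: norm_powr_real_powr)
    also have "\<dots> \<le> real n powr (- Re s - 1)"
      using t tpos assms by (intro powr_mono2') auto
    finally show "norm (- s * z powr (- s - 1)) \<le> norm s * real n powr (- Re s - 1)"
      by (simp add: norm_mult mult_left_mono)
  qed auto
  thus ?thesis by simp
qed

subsection \<open>The L-function and its derivative\<close>

lemma dirichlet_L_partial_sums_eq:
  fixes chi :: "nat \<Rightarrow> complex"
  shows "(\<Sum>n<M. chi (Suc n) / of_nat (Suc n) powr s) =
     (\<Sum>k\<in>{1..M}. chi k) * of_nat (Suc M) powr (-s)
     + (\<Sum>n<M. (\<Sum>k\<in>{1..Suc n}. chi k) * (of_nat (Suc n) powr (-s) - of_nat (Suc (Suc n)) powr (-s)))"
proof -
  have "(\<Sum>n<M. chi (Suc n) / of_nat (Suc n) powr s) = (\<Sum>n\<in>{0<..M}. of_nat n powr (-s) * chi n)"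
    by (rule sum.reindex_bij_witness[of _ "\<lambda>n. n - 1" Suc])
       (auto simp: powr_minus divide_simps)
  also have "\<dots> = of_nat (Suc M) powr (-s) * (\<Sum>k\<in>{1..M}. chi k)
      + (\<Sum>n\<in>{0<..M}. (of_nat n powr (-s) - of_nat (Suc n) powr (-s)) * (\<Sum>k\<in>{1..n}. chi k))"
    by (subst abel_summation) simp_all
  also have "(\<Sum>n\<in>{0<..M}. (of_nat n powr (-s) - of_nat (Suc n) powr (-s)) * (\<Sum>k\<in>{1..n}. chi k))
      = (\<Sum>n<M. (\<Sum>k\<in>{1..Suc n}. chi k) * (of_nat (Suc n) powr (-s) - of_nat (Suc (Suc n)) powr (-s)))"
    by (rule sum.reindex_bij_witness[of _ Suc "\<lambda>n. n - 1"]) auto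
  finally show ?thesis by (simp add: mult.commute)
qed

text \<open>Passes from the indexing in \<open>dirichlet_L\<close> to sums over
  \<open>{1..M}\<close> with real weights. The factor \<open>h\<close> is 1 for the L-function and
  the logarithm for its derivative.\<close>

lemma sum_dirichlet_series_real:
  fixes chi h :: "nat \<Rightarrow> complex"
  shows "(\<Sum>n<M. chi (Suc n) * h (Suc n) / of_nat (Suc n) powr (complex_of_real s)) =
     (\<Sum>n\<in>{1..M}. of_real (real n powr (-s)) * (chi n * h n))"
  by (rule sum.reindex_bij_witness[of _ "\<lambda>n. n - 1" Suc])
     (auto simp: powr_minus field_simps powr_of_real[symmetric])

context
  fixes q :: nat and chi :: "nat \<Rightarrow> complex"
  assumes prime_q: "prime q" and chi: "chi \<in> nonprincipal_chars q"
begin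

text \<open>Character sums are bounded by \<open>q\<close>, so Abel summation leaves terms of size
  at most a constant times \<open>n powr (-5/4)\<close> on this region. The region is bounded, which
  makes the majorant uniform, and it is an open set around the interval from 1/2 to 1, so the limit
  can be differentiated there.\<close>

lemma uniform_limit_dirichlet_L:
  "uniform_limit {s. Re s > 1 / 4 \<and> norm s < 2}
     (\<lambda>M s. \<Sum>n<M. chi (Suc n) / of_nat (Suc n) powr s) (dirichlet_L chi) sequentially"
proof -
  let ?A = "{s :: complex. Re s > 1 / 4 \<and> norm s < 2}"
  define S where "S n = (\<Sum>k\<in>{1..n}. chi k)" for n
  define g where "g n s = S (Suc n) * (of_nat (Suc n) powr (-s) - of_nat (Suc (Suc n)) powr (-s))" for n and s :: complex
  define f where "f M s = (\<Sum>n<M. chi (Suc n) / of_nat (Suc n) powr s)" for M and s :: complex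
  have S: "norm (S n) \<le> real q" for n
    unfolding S_def by (rule norm_sum_nonprincipal_char_le[OF prime_q chi])
  have f_eq: "f M s = S M * of_nat (Suc M) powr (-s) + (\<Sum>n<M. g n s)" for M s
    unfolding f_def g_def S_def by (rule dirichlet_L_partial_sums_eq)
  have lim1: "uniform_limit ?A (\<lambda>M s. \<Sum>n<M. g n s) (\<lambda>s. \<Sum>n. g n s) sequentially"
  proof (rule Weierstrass_m_test)
    fix n and s :: complex assume s: "s \<in> ?A"
    have "norm (g n s) \<le> real q * (norm s * real (Suc n) powr (- Re s - 1))"
      unfolding g_def norm_mult using s by (intro mult_mono S norm_powr_diff_le) auto
    also have "\<dots> \<le> real q * (2 * real (Suc n) powr (-5/4))"
      using s by (intro mult_left_mono mult_mono powr_mono) auto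
    finally show "norm (g n s) \<le> real q * (2 * real (Suc n) powr (-5/4))" .
  next
    have "summable (\<lambda>n. real n powr (-5/4))"
      by (simp add: summable_real_powr_iff)
    hence "summable (\<lambda>n. real (Suc n) powr (-5/4))"
      using summable_Suc_iff[of "\<lambda>n. real n powr (-5/4)"] by blast
    thus "summable (\<lambda>n. real q * (2 * real (Suc n) powr (-5/4)))"
      by (intro summable_mult)
  qed
  \<comment> \<open>The boundary term of the Abel summation vanishes uniformly because
    \<open>Re s > 1 / 4\<close>.\<close>
  have lim2: "uniform_limit ?A (\<lambda>M s. S M * of_nat (Suc M) powr (-s)) (\<lambda>s. 0) sequentially"
    unfolding uniform_limit_iff
  proof (intro allI impI)
    fix e :: real assume "e > 0"
    have "(\<lambda>M. real q * real (Suc M) powr (-1/4)) \<longlonglongrightarrow> 0"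
      by real_asymp
    hence "eventually (\<lambda>M. real q * real (Suc M) powr (-1/4) < e) sequentially"
      using \<open>e > 0\<close> by (rule order_tendstoD)
    thus "\<forall>\<^sub>F M in sequentially. \<forall>s\<in>?A. dist (S M * of_nat (Suc M) powr (-s)) 0 < e"
    proof eventually_elim
      case (elim M)
      show ?case
      proof
        fix s :: complex assume s: "s \<in> ?A"
        have "norm (of_nat (Suc M) powr (-s)) = real (Suc M) powr (- Re s)"
          by (subst norm_powr_real_powr) (simp_all del: of_nat_Suc)
        also have "\<dots> \<le> real (Suc M) powr (-1/4)"
          using s by (intro powr_mono) auto
        finally have "norm (S M * of_nat (Suc M) powr (-s)) \<le> real q * real (Suc M) powr (-1/4)"
          unfolding norm_mult by (intro mult_mono S) auto
        thus "dist (S M * of_nat (Suc M) powr (-s)) 0 < e"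
          using elim by simp
      qed
    qed
  qed
  have "uniform_limit ?A (\<lambda>M s. S M * of_nat (Suc M) powr (-s) + (\<Sum>n<M. g n s))
            (\<lambda>s. 0 + (\<Sum>n. g n s)) sequentially"
    by (rule uniform_limit_add[OF lim2 lim1])
  hence lim: "uniform_limit ?A f (\<lambda>s. \<Sum>n. g n s) sequentially"
    unfolding f_eq [symmetric] by simp
  have "(\<Sum>n. g n s) = dirichlet_L chi s" if "s \<in> ?A" for s
  proof -
    have "(\<lambda>M. f M s) \<longlonglongrightarrow> (\<Sum>n. g n s)"
      using tendsto_uniform_limitI[OF lim that] .
    hence "(\<lambda>n. chi (Suc n) / of_nat (Suc n) powr s) sums (\<Sum>n. g n s)"
      unfolding sums_def f_def .
    thus ?thesis unfolding dirichlet_L_def by (rule sums_unique)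
  qed
  hence "uniform_limit ?A f (dirichlet_L chi) sequentially"
    using uniform_limit_cong'[of ?A f f "\<lambda>s. \<Sum>n. g n s" "dirichlet_L chi" sequentially] lim by simp
  thus ?thesis unfolding f_def [abs_def] .
qed

lemma dirichlet_L_tendsto:
  assumes s: "s > 1 / 4" "s < 2"
  shows "(\<lambda>M. \<Sum>n\<in>{1..M}. of_real (real n powr (-s)) * chi n) \<longlonglongrightarrow> dirichlet_L chi (of_real s)"
  using tendsto_uniform_limitI[OF uniform_limit_dirichlet_L, of "of_real s"]
        sum_dirichlet_series_real[where h = "\<lambda>_. 1" and s = s] s by simp

text \<open>A locally uniform limit of holomorphic functions may be differentiated termwise. Each
  term acquires a factor \<open>- ln n\<close>, whence the sign.\<close>

lemma deriv_dirichlet_L_tendsto: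
  assumes s: "s > 1 / 4" "s < 2"
  shows "(\<lambda>M. \<Sum>n\<in>{1..M}. of_real (ln (real n) * real n powr (-s)) * chi n)
            \<longlonglongrightarrow> - deriv (dirichlet_L chi) (of_real s)"
proof -
  let ?A = "{s :: complex. Re s > 1 / 4 \<and> norm s < 2}"
  let ?f = "\<lambda>M s. \<Sum>n<M. chi (Suc n) / of_nat (Suc n) powr s"
  have der: "(?f M has_field_derivative (\<Sum>n<M. - (chi (Suc n) * ln (of_nat (Suc n)) / of_nat (Suc n) powr z))) (at z)" for M z
    by (auto intro!: derivative_eq_intros sum.cong simp del: of_nat_Suc simp: divide_simps)
  have A: "open ?A" "of_real s \<in> ?A"
    using s by (auto intro!: open_Collect_conj open_Collect_less continuous_intros)
  have "(\<lambda>M. deriv (?f M) (of_real s)) \<longlonglongrightarrow> deriv (dirichlet_L chi) (of_real s)"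
  proof (rule deriv_complex_uniform_limit[OF uniform_limit_dirichlet_L _ _ A])
    show "\<forall>\<^sub>F M in sequentially. ?f M holomorphic_on ?A"
      using der by (intro always_eventually allI holomorphic_onI)
         (meson field_differentiable_at_within field_differentiable_def)
  qed auto
  hence "(\<lambda>M. - deriv (?f M) (of_real s)) \<longlonglongrightarrow> - deriv (dirichlet_L chi) (of_real s)"
    by (rule tendsto_minus)
  moreover have "- deriv (?f M) (of_real s) = (\<Sum>n\<in>{1..M}. of_real (ln (real n) * real n powr (-s)) * chi n)" for M
  proof -
    have "- deriv (?f M) (of_real s) = (\<Sum>n<M. chi (Suc n) * ln (of_nat (Suc n)) / of_nat (Suc n) powr (of_real s))"
      using DERIV_imp_deriv[OF der, of M "of_real s"] by (simp add: sum_negf)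
    also have "\<dots> = (\<Sum>n\<in>{1..M}. of_real (real n powr (-s)) * (chi n * ln (of_nat n)))"
      by (rule sum_dirichlet_series_real)
    also have "\<dots> = (\<Sum>n\<in>{1..M}. of_real (ln (real n) * real n powr (-s)) * chi n)"
    proof (intro sum.cong refl)
      fix n assume n: "n \<in> {1..M}"
      have "ln (complex_of_nat n) = of_real (ln (real n))"
        using Ln_of_real[of "real n"] n by simp
      thus "of_real (real n powr - s) * (chi n * ln (of_nat n)) = of_real (ln (real n) * real n powr - s) * chi n"
        by simp
    qed
    finally show ?thesis .
  qed
  ultimately show ?thesis by simp
qed

end

subsection \<open>Divisor sums and the Moebius function\<close>

definition moebius :: "nat \<Rightarrow> real" where
  "moebius n = (if squarefree n then (-1) ^ card (prime_factors n) else 0)"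

lemma abs_moebius_le: "\<bar>moebius n\<bar> \<le> 1"
  by (simp add: moebius_def power_abs)

lemma moebius_prime_mult:
  assumes "prime p" "\<not> p dvd d" "d > 0"
  shows   "moebius (p * d) = - moebius d"
proof -
  have co: "coprime p d" using assms prime_imp_coprime by blast
  have "squarefree p" using assms(1) by (simp add: squarefree_prime)
  hence sq: "squarefree (p * d) \<longleftrightarrow> squarefree d"
    using co squarefree_mult_coprime[OF co] squarefree_multD(2) by blast
  have "prime_factors (p * d) = insert p (prime_factors d)"
    using assms prime_factors_product[of p d] prime_factorization_prime[of p] by auto
  moreover have "p \<notin> prime_factors d" using assms by auto
  ultimately show ?thesis using sq by (simp add: moebius_def)
qed

text \<open>For a prime \<open>p\<close> dividing \<open>n\<close>, the squarefree divisors form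
  pairs \<open>d\<close>, \<open>p * d\<close> with \<open>p\<close> not dividing \<open>d\<close>,
  and the members of a pair cancel.\<close>

lemma sum_moebius_divisors:
  assumes "n > 0"
  shows   "(\<Sum>d | d dvd n. moebius d) = (if n = 1 then 1 else 0)"
proof (cases "n = 1")
  case True
  thus ?thesis by (simp add: moebius_def)
next
  case False
  then obtain p where p: "prime p" "p dvd n" using prime_factor_nat by blast
  have p0: "p > 0" using p(1) by (simp add: prime_gt_0_nat)
  let ?A = "{d. d dvd n \<and> squarefree d \<and> \<not> p dvd d}" and ?B = "{d. d dvd n \<and> squarefree d \<and> p dvd d}"
  have fin: "finite {d. d dvd n}" using assms by simp
  have "(\<Sum>d | d dvd n. moebius d) = (\<Sum>d\<in>?A \<union> ?B. moebius d)"
    using fin by (intro sum.mono_neutral_right) (auto simp: moebius_def)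
  also have "\<dots> = (\<Sum>d\<in>?A. moebius d) + (\<Sum>d\<in>?B. moebius d)"
    by (intro sum.union_disjoint finite_subset[OF _ fin]) auto
  also have "(\<Sum>d\<in>?B. moebius d) = (\<Sum>d\<in>?A. moebius (p * d))"
  proof (rule sum.reindex_bij_witness[of _ "\<lambda>d. p * d" "\<lambda>d. d div p"])
    fix d assume d: "d \<in> ?A"
    have "coprime p d" using d p prime_imp_coprime by auto
    hence "squarefree (p * d)" "p * d dvd n"
      using d p by (auto simp: squarefree_prime intro!: squarefree_mult_coprime divides_mult)
    thus "p * d \<in> ?B" by auto
    show "p * d div p = d" using p0 by simp
  next
    fix d assume d: "d \<in> ?B"
    then obtain e where e: "d = p * e" by (auto elim: dvdE)
    have "\<not> p dvd e"
    proof
      assume "p dvd e"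
      hence "p ^ 2 dvd d" using e by (simp add: power2_eq_square)
      hence "is_unit p" using d squarefreeD[of d p] by auto
      thus False using p(1) by auto
    qed
    moreover have "e dvd n" "squarefree e"
      using d e squarefree_multD(2)[of p e] by (auto dest: dvd_mult_right)
    ultimately show "d div p \<in> ?A" using e p0 by simp
    show "p * (d div p) = d" using d by simp
    show "moebius (p * (d div p)) = moebius d" using d by simp
  qed
  also have "\<dots> = (\<Sum>d\<in>?A. - moebius d)"
    using p assms by (intro sum.cong refl moebius_prime_mult) (auto intro: Nat.gr0I)
  finally show ?thesis using False by (simp add: sum_negf)
qed

text \<open>The map from \<open>(n, d)\<close> to \<open>(d, n div d)\<close> is injective into a
  square, and nonnegative terms may be added to fill it.\<close>

lemma sum_divisor_convolution_le:
  fixes u v :: "nat \<Rightarrow> real"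
  assumes "\<And>n. u n \<ge> 0" "\<And>n. v n \<ge> 0"
  shows "(\<Sum>n\<in>{1..X}. \<Sum>d | d dvd n. u d * v (n div d)) \<le> (\<Sum>n\<in>{1..X}. u n) * (\<Sum>n\<in>{1..X}. v n)"
proof -
  let ?S = "SIGMA n:{1..X}. {d. d dvd n}"
  have fin: "finite ?S" by (intro finite_SigmaI) auto
  have "(\<Sum>n\<in>{1..X}. \<Sum>d | d dvd n. u d * v (n div d)) = (\<Sum>(n, d)\<in>?S. u d * v (n div d))"
    by (subst sum.Sigma) auto
  also have "\<dots> = (\<Sum>(d, e)\<in>(\<lambda>(n, d). (d, n div d)) ` ?S. u d * v e)"
  proof (subst sum.reindex)
    show "inj_on (\<lambda>(n, d). (d, n div d)) ?S"
      by (rule inj_on_inverseI[where g = "\<lambda>(d, e). (d * e, d)"]) auto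
  qed (auto intro!: sum.cong)
  also have "\<dots> \<le> (\<Sum>(d, e)\<in>{1..X} \<times> {1..X}. u d * v e)"
  proof (rule sum_mono2)
    show "(\<lambda>(n, d). (d, n div d)) ` ?S \<subseteq> {1..X} \<times> {1..X}"
    proof clarsimp
      fix n d assume n: "Suc 0 \<le> n" "n \<le> X" "d dvd n"
      then obtain e where e: "n = d * e" by (elim dvdE)
      have "d > 0" "e > 0" using n e by (auto intro: Nat.gr0I)
      hence "d \<le> n" "e \<le> n" using e by auto
      hence "d \<le> X" "e \<le> X" using n(2) by linarith+
      thus "Suc 0 \<le> d \<and> d \<le> X \<and> Suc 0 \<le> n div d \<and> n div d \<le> X"
        using n e \<open>d > 0\<close> \<open>e > 0\<close> by auto
    qed
  qed (use assms in auto)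
  also have "\<dots> = (\<Sum>n\<in>{1..X}. u n) * (\<Sum>n\<in>{1..X}. v n)"
    by (simp add: sum_product sum.cartesian_product)
  finally show ?thesis .
qed

lemma card_divisors_mult_le:
  assumes "a > 0" "b > (0::nat)"
  shows   "card {d. d dvd a * b} \<le> card {d. d dvd a} * card {d. d dvd b}"
proof -
  have "{d. d dvd a * b} \<subseteq> (\<lambda>(x, y). x * y) ` ({d. d dvd a} \<times> {d. d dvd b})"
    by (auto elim!: dvd_productE simp: image_iff)
  hence "card {d. d dvd a * b} \<le> card ({d. d dvd a} \<times> {d. d dvd b})"
    using assms by (intro surj_card_le) auto
  thus ?thesis by (simp add: card_cartesian_product)
qed

text \<open>The divisor function is the convolution of 1 with itself, and by submultiplicativity its
  square is at most its convolution with itself. Hence the square is dominated by a fourfold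
  convolution of 1, each factor of which gives one truncated zeta sum.\<close>

lemma sum_card_divisors_sq_le:
  fixes s :: real
  shows "(\<Sum>n\<in>{1..X}. (real (card {d. d dvd n}))\<^sup>2 * real n powr (-s)) \<le> (\<Sum>n\<in>{1..X}. real n powr (-s)) ^ 4"
proof -
  define t where "t n = real (card {d. d dvd n})" for n :: nat
  define Z where "Z = (\<Sum>n\<in>{1..X}. real n powr (-s))"
  have split: "real n powr (-s) = real d powr (-s) * real (n div d) powr (-s)" if "d dvd n" for n d
  proof -
    have "real n = real d * real (n div d)" using that by (metis dvd_mult_div_cancel of_nat_mult)
    thus ?thesis by (simp add: powr_mult)
  qed
  have Z1: "(\<Sum>n\<in>{1..X}. t n * real n powr (-s)) \<le> Z * Z"
  proof -
    have "(\<Sum>n\<in>{1..X}. t n * real n powr (-s)) = (\<Sum>n\<in>{1..X}. \<Sum>d | d dvd n. real d powr (-s) * real (n div d) powr (-s))"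
      by (intro sum.cong refl) (simp add: t_def split [symmetric])
    also have "\<dots> \<le> Z * Z" unfolding Z_def
      by (rule sum_divisor_convolution_le) auto
    finally show ?thesis .
  qed
  \<comment> \<open>One factor \<open>t n\<close> becomes a sum over the divisors \<open>d\<close>;
    the other is then split along \<open>n = d * (n div d)\<close>.\<close>
  have "(\<Sum>n\<in>{1..X}. (t n)\<^sup>2 * real n powr (-s)) = (\<Sum>n\<in>{1..X}. \<Sum>d | d dvd n. t n * real n powr (-s))"
    by (intro sum.cong refl) (simp add: t_def power2_eq_square)
  also have "\<dots> \<le> (\<Sum>n\<in>{1..X}. \<Sum>d | d dvd n. (t d * real d powr (-s)) * (t (n div d) * real (n div d) powr (-s)))"
  proof (intro sum_mono)
    fix n d :: nat assume n: "n \<in> {1..X}" and d: "d \<in> {d. d dvd n}"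
    then obtain e where e: "n = d * e" by (auto elim: dvdE)
    have pos: "d > 0" "e > 0" using n e by (auto intro: Nat.gr0I)
    have "t n \<le> t d * t e"
      unfolding t_def e of_nat_mult [symmetric] of_nat_le_iff by (rule card_divisors_mult_le[OF pos])
    hence "t n * real n powr (-s) \<le> (t d * t e) * (real d powr (-s) * real e powr (-s))"
      unfolding e by (intro mult_mono) (auto simp: powr_mult t_def)
    thus "t n * real n powr (-s) \<le> (t d * real d powr (-s)) * (t (n div d) * real (n div d) powr (-s))"
      using pos e by (simp add: mult_ac)
  qed
  also have "\<dots> \<le> (\<Sum>n\<in>{1..X}. t n * real n powr (-s)) * (\<Sum>n\<in>{1..X}. t n * real n powr (-s))"
    by (rule sum_divisor_convolution_le) (auto simp: t_def)
  also have "\<dots> \<le> (Z * Z) * (Z * Z)"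
    by (intro mult_mono Z1 mult_nonneg_nonneg sum_nonneg) (auto simp: t_def Z_def intro!: sum_nonneg)
  finally show ?thesis by (simp add: t_def Z_def power4_eq_xxxx mult_ac)
qed

section \<open>Bounded sums that serve as majorants in the mean squares\<close>

lemma sum_powr_bounded:
  fixes s :: real
  assumes "s > 1"
  obtains K where "\<And>X. (\<Sum>n\<in>{1..X}. real n powr (-s)) \<le> K"
proof
  fix X
  show "(\<Sum>n\<in>{1..X}. real n powr (-s)) \<le> (\<Sum>n. real n powr (-s))"
    using assms by (intro sum_le_suminf) (auto simp: summable_real_powr_iff)
qed

lemma sum_card_divisors_sq_bounded:
  fixes s :: real
  assumes "s > 1"
  obtains K where "\<And>X. (\<Sum>n\<in>{1..X}. (real (card {d. d dvd n}))\<^sup>2 * real n powr (-s)) \<le> K"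
proof -
  obtain K where K: "\<And>X. (\<Sum>n\<in>{1..X}. real n powr (-s)) \<le> K" using sum_powr_bounded[OF assms] by blast
  have "(\<Sum>n\<in>{1..X}. (real (card {d. d dvd n}))\<^sup>2 * real n powr (-s)) \<le> K ^ 4" for X
    by (rule order_trans[OF sum_card_divisors_sq_le power_mono[OF K]]) (auto intro: sum_nonneg)
  thus ?thesis using that by blast
qed

lemma sum_ln_sq_bounded:
  fixes s :: real
  assumes "s > 1"
  obtains K where "\<And>X. (\<Sum>n\<in>{1..X}. (ln (real n))\<^sup>2 * real n powr (-s)) \<le> K"
proof -
  \<comment> \<open>With this choice \<open>s - 2 * e = (s + 1) / 2\<close> stays above 1 when
    \<open>ln n\<close> is replaced by \<open>n powr e / e\<close>.\<close>
  define e where "e = (s - 1) / 4"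
  have e: "e > 0" "s - 2 * e > 1" using assms by (auto simp: e_def field_simps)
  obtain K where K: "\<And>X. (\<Sum>n\<in>{1..X}. real n powr (-(s - 2 * e))) \<le> K" using sum_powr_bounded[OF e(2)] by blast
  have "(\<Sum>n\<in>{1..X}. (ln (real n))\<^sup>2 * real n powr (-s)) \<le> K / e\<^sup>2" for X
  proof -
    have "(\<Sum>n\<in>{1..X}. (ln (real n))\<^sup>2 * real n powr (-s)) \<le> (\<Sum>n\<in>{1..X}. real n powr (-(s - 2 * e)) / e\<^sup>2)"
    proof (rule sum_mono)
      fix n assume n: "n \<in> {1..X}"
      have "ln (real n) \<le> real n powr e / e" using n e by (intro ln_powr_bound) auto
      hence "(ln (real n))\<^sup>2 \<le> (real n powr e / e)\<^sup>2" using n by (intro power_mono) auto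
      also have "(real n powr e / e)\<^sup>2 = real n powr (2 * e) / e\<^sup>2"
        by (simp add: power_divide power2_eq_square flip: powr_add)
      finally have "(ln (real n))\<^sup>2 * real n powr (-s) \<le> real n powr (2 * e) / e\<^sup>2 * real n powr (-s)"
        by (intro mult_right_mono) auto
      also have "\<dots> = real n powr (-(s - 2 * e)) / e\<^sup>2"
        by (simp flip: powr_add)
      finally show "(ln (real n))\<^sup>2 * real n powr (-s) \<le> real n powr (-(s - 2 * e)) / e\<^sup>2" .
    qed
    also have "\<dots> = (\<Sum>n\<in>{1..X}. real n powr (-(s - 2 * e))) / e\<^sup>2"
      by (simp add: sum_divide_distrib)
    also have "\<dots> \<le> K / e\<^sup>2" by (intro divide_right_mono K) auto
    finally show ?thesis .
  qed
  thus ?thesis using that by blast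
qed

text \<open>Groups the pairs by their product \<open>k\<close>. The conditions
  \<open>d \<le> y\<close> and \<open>k div d \<le> N\<close> keep track of the rectangle; they hold
  automatically when \<open>k\<close> is at most \<open>y\<close> and \<open>N\<close>.\<close>

lemma sum_product_by_value:
  fixes F :: "nat \<Rightarrow> nat \<Rightarrow> 'a :: comm_monoid_add"
  shows "(\<Sum>n\<in>{1..N}. \<Sum>d\<in>{1..y}. F n d) =
         (\<Sum>k\<in>{1..y * N}. \<Sum>d | d dvd k \<and> d \<le> y \<and> k div d \<le> N. F (k div d) d)"
proof -
  have fin: "finite {d. d dvd k \<and> d \<le> y \<and> k div d \<le> N}" for k
    by (rule finite_subset[of _ "{..y}"]) auto
  have "(\<Sum>n\<in>{1..N}. \<Sum>d\<in>{1..y}. F n d) = (\<Sum>(n, d)\<in>{1..N} \<times> {1..y}. F n d)"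
    by (simp add: sum.cartesian_product)
  also have "\<dots> = (\<Sum>(k, d)\<in>(SIGMA k:{1..y * N}. {d. d dvd k \<and> d \<le> y \<and> k div d \<le> N}). F (k div d) d)"
  proof (rule sum.reindex_bij_witness[of _ "\<lambda>(k, d). (k div d, d)" "\<lambda>(n, d). (n * d, d)"])
    fix x assume x: "x \<in> (SIGMA k:{1..y * N}. {d. d dvd k \<and> d \<le> y \<and> k div d \<le> N})"
    then obtain k d where kd: "x = (k, d)" "k \<ge> 1" "d dvd k" "d \<le> y" "k div d \<le> N" by auto
    have "d > 0" "k div d > 0"
      using kd by (auto intro!: Nat.gr0I simp: dvd_div_eq_0_iff)
    thus "(case x of (k, d) \<Rightarrow> (k div d, d)) \<in> {1..N} \<times> {1..y}" using kd by auto
    show "(case case x of (k, d) \<Rightarrow> (k div d, d) of (n, d) \<Rightarrow> (n * d, d)) = x" using kd by auto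
  next
    fix x assume x: "x \<in> {1..N} \<times> {1..y}"
    then obtain n d where nd: "x = (n, d)" "n \<ge> 1" "n \<le> N" "d \<ge> 1" "d \<le> y" by auto
    have "n * d \<le> N * y" "n * d \<ge> 1" using nd by (auto intro: mult_le_mono)
    thus "(case x of (n, d) \<Rightarrow> (n * d, d)) \<in> (SIGMA k:{1..y * N}. {d. d dvd k \<and> d \<le> y \<and> k div d \<le> N})"
      using nd by (auto simp: mult.commute)
    show "(case case x of (n, d) \<Rightarrow> (n * d, d) of (k, d) \<Rightarrow> (k div d, d)) = x" using nd by auto
    show "(case case x of (n, d) \<Rightarrow> (n * d, d) of (k, d) \<Rightarrow> F (k div d) d) = (case x of (n, d) \<Rightarrow> F n d)"
      using nd by auto
  qed
  also have "\<dots> = (\<Sum>k\<in>{1..y * N}. \<Sum>d | d dvd k \<and> d \<le> y \<and> k div d \<le> N. F (k div d) d)"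
    using fin by (subst sum.Sigma) auto
  finally show ?thesis .
qed

subsection \<open>Mollified mean squares\<close>

lemma L2_set_limit_le:
  fixes F :: "nat \<Rightarrow> 'a \<Rightarrow> 'b :: real_normed_vector"
  assumes lim: "\<And>x. x \<in> X \<Longrightarrow> (\<lambda>M. F M x) \<longlonglongrightarrow> G x"
    and le: "eventually (\<lambda>M. L2_set (\<lambda>x. norm (F M x)) X \<le> B) sequentially"
  shows "L2_set (\<lambda>x. norm (G x)) X \<le> B"
proof (rule tendsto_upperbound[OF _ le])
  show "(\<lambda>M. L2_set (\<lambda>x. norm (F M x)) X) \<longlonglongrightarrow> L2_set (\<lambda>x. norm (G x)) X"
    unfolding L2_set_def by (intro tendsto_intros lim)
qed simp

context
  fixes q :: nat
  assumes prime_q: "prime q"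
begin

text \<open>The product of the truncated L-series and the polynomial with coefficients
  \<open>a\<close> has the divisor sums \<open>e\<close> as coefficients, up to truncation. For
  \<open>k \<le> y\<close> truncation has no effect and the terms cancel against the subtracted sum.
  Only \<open>k > y\<close> remain, and \<open>y * N < q\<close> brings them within reach of
  Parseval.\<close>

lemma dirichlet_polynomial_product_mean_square:
  fixes a e h :: "nat \<Rightarrow> real" and s :: real
  assumes y: "0 < y" "y \<le> N" "y * N < q"
    and conv: "\<And>k. k > 0 \<Longrightarrow> (\<Sum>d | d dvd k. a d) = e k"
    and h: "\<And>k. k > 0 \<Longrightarrow> (\<Sum>d | d dvd k. \<bar>a d\<bar>) \<le> h k"
  shows "L2_set (\<lambda>chi. norm ((\<Sum>n\<in>{1..N}. of_real (real n powr (-s)) * chi n) *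
             (\<Sum>d\<in>{1..y}. of_real (a d * real d powr (-s)) * chi d)
           - (\<Sum>k\<in>{1..N}. of_real (e k * real k powr (-s)) * chi k))) (nonprincipal_chars q)
       \<le> sqrt (real q * (\<Sum>k\<in>{y<..y * N}. 4 * (h k)\<^sup>2 * real k powr (-(2 * s))))"
proof -
  define c where "c k = (\<Sum>d | d dvd k \<and> d \<le> y \<and> k div d \<le> N. a d)" for k
  define b where "b k = (c k - (if k \<le> N then e k else 0)) * real k powr (-s)" for k
  have fin: "finite {d. d dvd k \<and> d \<le> y \<and> k div d \<le> N}" for k
    by (rule finite_subset[of _ "{..y}"]) auto
  \<comment> \<open>Every divisor \<open>d\<close> of such a \<open>k\<close> has
    \<open>d \<le> y\<close> and \<open>k div d \<le> k \<le> N\<close>, so \<open>c k\<close> is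
    the complete divisor sum \<open>e k\<close>.\<close>
  have b0: "b k = 0" if "k \<in> {1..y}" for k
  proof -
    have "d \<le> y \<and> k div d \<le> N" if "d dvd k" for d
      using \<open>k \<in> {1..y}\<close> y(2) dvd_imp_le[OF that] order_trans[OF div_le_dividend[of k d], of N] by auto
    hence "{d. d dvd k \<and> d \<le> y \<and> k div d \<le> N} = {d. d dvd k}" by auto
    hence "c k = e k" using conv[of k] that by (simp add: c_def)
    thus ?thesis using that y by (simp add: b_def)
  qed
  \<comment> \<open>Both \<open>c k\<close> and \<open>e k\<close> are at most \<open>h k\<close> in
    absolute value, whence the factor \<open>4 = 2 ^ 2\<close>.\<close>
  have b_le: "(b k)\<^sup>2 \<le> 4 * (h k)\<^sup>2 * real k powr (-(2 * s))" if "k > 0" for k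
  proof -
    have "\<bar>c k\<bar> \<le> (\<Sum>d | d dvd k \<and> d \<le> y \<and> k div d \<le> N. \<bar>a d\<bar>)"
      unfolding c_def by (rule sum_abs)
    also have "\<dots> \<le> (\<Sum>d | d dvd k. \<bar>a d\<bar>)"
      using that by (intro sum_mono2) auto
    finally have "\<bar>c k\<bar> \<le> h k" using h[OF that] by linarith
    moreover have "\<bar>e k\<bar> \<le> h k"
      unfolding conv[OF that, symmetric] using h[OF that] by (rule order_trans[OF sum_abs])
    ultimately have "\<bar>c k - (if k \<le> N then e k else 0)\<bar> \<le> 2 * h k" by auto
    hence "(c k - (if k \<le> N then e k else 0))\<^sup>2 \<le> (2 * h k)\<^sup>2"
      by (intro abs_le_square_iff[THEN iffD1]) auto
    moreover have "(real k powr (-s))\<^sup>2 = real k powr (-(2 * s))"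
      by (simp add: power2_eq_square flip: powr_add)
    ultimately show ?thesis
      unfolding b_def power_mult_distrib by (simp add: mult_right_mono)
  qed
  have "(\<Sum>n\<in>{1..N}. of_real (real n powr (-s)) * chi n) *
             (\<Sum>d\<in>{1..y}. of_real (a d * real d powr (-s)) * chi d)
           - (\<Sum>k\<in>{1..N}. of_real (e k * real k powr (-s)) * chi k) =
        (\<Sum>k\<in>{y<..y * N}. of_real (b k) * chi k)" (is "?D * ?A - ?E = _")
    if chi: "dirichlet_char q chi" for chi
  proof -
    have "?D * ?A = (\<Sum>n\<in>{1..N}. \<Sum>d\<in>{1..y}.
            of_real (real n powr (-s)) * chi n * (of_real (a d * real d powr (-s)) * chi d))"
      by (rule sum_product)
    also have "\<dots> = (\<Sum>k\<in>{1..y * N}. \<Sum>d | d dvd k \<and> d \<le> y \<and> k div d \<le> N.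
        of_real (real (k div d) powr (-s)) * chi (k div d) * (of_real (a d * real d powr (-s)) * chi d))"
      by (rule sum_product_by_value)
    also have "\<dots> = (\<Sum>k\<in>{1..y * N}. of_real (c k * real k powr (-s)) * chi k)"
    proof (rule sum.cong[OF refl])
      fix k assume k: "k \<in> {1..y * N}"
      have "(\<Sum>d | d dvd k \<and> d \<le> y \<and> k div d \<le> N.
        of_real (real (k div d) powr (-s)) * chi (k div d) * (of_real (a d * real d powr (-s)) * chi d)) =
        (\<Sum>d | d dvd k \<and> d \<le> y \<and> k div d \<le> N. of_real (a d) * (of_real (real k powr (-s)) * chi k))"
      proof (rule sum.cong[OF refl])
        fix d assume d: "d \<in> {d. d dvd k \<and> d \<le> y \<and> k div d \<le> N}"
        then obtain n where n: "k = d * n" by (auto elim: dvdE)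
        have "d > 0" using n k by (auto intro: Nat.gr0I)
        thus "of_real (real (k div d) powr (-s)) * chi (k div d) * (of_real (a d * real d powr (-s)) * chi d)
          = of_real (a d) * (of_real (real k powr (-s)) * chi k)"
          unfolding n by (simp add: powr_mult dirichlet_char_mult[OF chi])
      qed
      thus "(\<Sum>d | d dvd k \<and> d \<le> y \<and> k div d \<le> N.
        of_real (real (k div d) powr (-s)) * chi (k div d) * (of_real (a d * real d powr (-s)) * chi d)) =
         of_real (c k * real k powr (-s)) * chi k"
        by (simp add: c_def sum_distrib_right mult.assoc)
    qed
    finally have DA: "?D * ?A = (\<Sum>k\<in>{1..y * N}. of_real (c k * real k powr (-s)) * chi k)" .
    have sub: "{1..N} \<subseteq> {1..y * N}" using y by auto
    have "?E = (\<Sum>k\<in>{1..y * N}. of_real ((if k \<le> N then e k else 0) * real k powr (-s)) * chi k)"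
      using sub by (intro sum.mono_neutral_cong_left) auto
    with DA have "?D * ?A - ?E = (\<Sum>k\<in>{1..y * N}. of_real (b k) * chi k)"
      by (simp only: sum_subtractf [symmetric]) (simp add: b_def algebra_simps)
    also have "\<dots> = (\<Sum>k\<in>{y<..y * N}. of_real (b k) * chi k)"
      using b0 y by (intro sum.mono_neutral_right) auto
    finally show ?thesis .
  qed
  hence "L2_set (\<lambda>chi. norm ((\<Sum>n\<in>{1..N}. of_real (real n powr (-s)) * chi n) *
             (\<Sum>d\<in>{1..y}. of_real (a d * real d powr (-s)) * chi d)
           - (\<Sum>k\<in>{1..N}. of_real (e k * real k powr (-s)) * chi k))) (nonprincipal_chars q)
     = L2_set (\<lambda>chi. norm (\<Sum>k\<in>{y<..y * N}. of_real (b k) * chi k)) (nonprincipal_chars q)"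
    by (intro L2_set_cong refl) (simp add: nonprincipal_chars_def)
  also have "\<dots> \<le> sqrt (real q * (\<Sum>k\<in>{y<..y * N}. (b k)\<^sup>2))"
    using y by (intro L2_char_sum_le prime_q nonprincipal_chars_subset) auto
  also have "\<dots> \<le> sqrt (real q * (\<Sum>k\<in>{y<..y * N}. 4 * (h k)\<^sup>2 * real k powr (-(2 * s))))"
    using b_le by (intro real_sqrt_le_mono mult_left_mono sum_mono) auto
  finally show ?thesis .
qed

text \<open>Both infinite series are cut at \<open>N\<close>: \<open>L * A - E\<close> is the
  difference for the finite sums, plus \<open>(L - D N) * A\<close>, minus the tail of
  \<open>E\<close>. The tails are small in mean square by \<open>L2_nonprincipal_tail_le\<close>, so
  a trivial bound for \<open>A\<close> suffices.\<close>

lemma dirichlet_L_mollified_mean_square: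
  fixes a e h :: "nat \<Rightarrow> real" and E :: "(nat \<Rightarrow> complex) \<Rightarrow> complex" and s :: real
  assumes s: "1 / 2 \<le> s" "s < 1" and y: "0 < y" "y \<le> N" "y * N < q"
    and conv: "\<And>k. k > 0 \<Longrightarrow> (\<Sum>d | d dvd k. a d) = e k"
    and h: "\<And>k. k > 0 \<Longrightarrow> (\<Sum>d | d dvd k. \<bar>a d\<bar>) \<le> h k"
    and a_le: "\<And>d. d > 0 \<Longrightarrow> \<bar>a d\<bar> \<le> real d powr (1 / 2)"
    and e_nonneg: "\<And>k. k > N \<Longrightarrow> e k \<ge> 0"
    and e_anti: "\<And>k. k > N \<Longrightarrow> e (Suc k) * real (Suc k) powr (-s) \<le> e k * real k powr (-s)"
    and E: "\<And>chi. chi \<in> nonprincipal_chars q \<Longrightarrow>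
               (\<lambda>M. \<Sum>k\<in>{1..M}. of_real (e k * real k powr (-s)) * chi k) \<longlonglongrightarrow> E chi"
  shows "L2_set (\<lambda>chi. norm (dirichlet_L chi (of_real s) * (\<Sum>d\<in>{1..y}. of_real (a d * real d powr (-s)) * chi d)
            - E chi)) (nonprincipal_chars q)
       \<le> sqrt (real q * (\<Sum>k\<in>{y<..y * N}. 4 * (h k)\<^sup>2 * real k powr (-(2 * s))))
         + 2 * real q * (real y + e (Suc N)) * real (Suc N) powr (-s)"
proof -
  let ?X = "nonprincipal_chars q"
  define A where "A chi = (\<Sum>d\<in>{1..y}. of_real (a d * real d powr (-s)) * chi d)" for chi :: "nat \<Rightarrow> complex"
  define D where "D M chi = (\<Sum>n\<in>{1..M}. of_real (real n powr (-s)) * chi n)" for M and chi :: "nat \<Rightarrow> complex"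
  define P where "P M chi = (\<Sum>k\<in>{1..M}. of_real (e k * real k powr (-s)) * chi k)" for M and chi :: "nat \<Rightarrow> complex"
  define L where "L chi = dirichlet_L chi (of_real s)" for chi
  have q: "q > 0" using prime_gt_0_nat[OF prime_q] .
  have diff: "(\<Sum>n\<in>{1..M}. f n) - (\<Sum>n\<in>{1..N}. f n) = (\<Sum>n\<in>{N<..M}. f n)"
    if "M \<ge> N" for M and f :: "nat \<Rightarrow> complex"
  proof -
    have "{1..M} = {1..N} \<union> {N<..M}" using that by auto
    show ?thesis
      unfolding \<open>{1..M} = {1..N} \<union> {N<..M}\<close> by (subst sum.union_disjoint) auto
  qed
  have D_tail: "L2_set (\<lambda>chi. norm (L chi - D N chi)) ?X \<le> 2 * real q * real (Suc N) powr (-s)"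
  proof (rule L2_set_limit_le[where F = "\<lambda>M chi. D M chi - D N chi"])
    show "(\<lambda>M. D M chi - D N chi) \<longlonglongrightarrow> L chi - D N chi" if "chi \<in> ?X" for chi
      unfolding D_def L_def by (intro tendsto_diff dirichlet_L_tendsto[OF prime_q that] tendsto_const) (use s in auto)
    show "\<forall>\<^sub>F M in sequentially. L2_set (\<lambda>chi. norm (D M chi - D N chi)) ?X \<le> 2 * real q * real (Suc N) powr (-s)"
    proof (rule eventually_sequentiallyI[of N])
      fix M assume M: "M \<ge> N"
      show "L2_set (\<lambda>chi. norm (D M chi - D N chi)) ?X \<le> 2 * real q * real (Suc N) powr (-s)"
        unfolding D_def diff[OF M]
        by (rule L2_nonprincipal_tail_le[OF prime_q M]) (use s in \<open>auto intro!: powr_mono2'\<close>)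
    qed
  qed
  have P_tail: "L2_set (\<lambda>chi. norm (E chi - P N chi)) ?X \<le> 2 * real q * (e (Suc N) * real (Suc N) powr (-s))"
  proof (rule L2_set_limit_le[where F = "\<lambda>M chi. P M chi - P N chi"])
    show "(\<lambda>M. P M chi - P N chi) \<longlonglongrightarrow> E chi - P N chi" if "chi \<in> ?X" for chi
      unfolding P_def by (intro tendsto_diff E[OF that] tendsto_const)
    show "\<forall>\<^sub>F M in sequentially. L2_set (\<lambda>chi. norm (P M chi - P N chi)) ?X \<le> 2 * real q * (e (Suc N) * real (Suc N) powr (-s))"
    proof (rule eventually_sequentiallyI[of N])
      fix M assume M: "M \<ge> N"
      show "L2_set (\<lambda>chi. norm (P M chi - P N chi)) ?X \<le> 2 * real q * (e (Suc N) * real (Suc N) powr (-s))"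
        unfolding P_def diff[OF M]
        by (rule L2_nonprincipal_tail_le[OF prime_q M]) (use e_anti e_nonneg in auto)
    qed
  qed
  \<comment> \<open>The growth allowed for \<open>a\<close> is offset by
    \<open>s \<ge> 1 / 2\<close>, so each term has norm at most 1.\<close>
  have A_le: "norm (A chi) \<le> real y" if "chi \<in> ?X" for chi
  proof -
    have dc: "dirichlet_char q chi" using that by (simp add: nonprincipal_chars_def)
    have "norm (A chi) \<le> (\<Sum>d\<in>{1..y}. 1)"
      unfolding A_def
    proof (rule sum_norm_le)
      fix d assume d: "d \<in> {1..y}"
      have "norm (of_real (a d * real d powr (-s)) * chi d) = \<bar>a d\<bar> * real d powr (-s) * norm (chi d)"
        by (simp add: norm_mult abs_mult)
      also have "\<dots> \<le> real d powr (1 / 2) * real d powr (-(1 / 2)) * 1"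
        using d s by (intro mult_mono a_le norm_dirichlet_char_le[OF dc q] powr_mono) auto
      also have "\<dots> = 1" using d by (simp flip: powr_add)
      finally show "norm (of_real (a d * real d powr (-s)) * chi d) \<le> 1" .
    qed
    thus ?thesis by simp
  qed
  have "L2_set (\<lambda>chi. norm (L chi * A chi - E chi)) ?X
      \<le> L2_set (\<lambda>chi. norm (D N chi * A chi - P N chi) + norm (L chi - D N chi) * real y + norm (E chi - P N chi)) ?X"
  proof (rule L2_set_mono)
    fix chi assume chi: "chi \<in> ?X"
    have "norm (L chi * A chi - E chi) = norm ((D N chi * A chi - P N chi) + (L chi - D N chi) * A chi - (E chi - P N chi))"
      by (simp add: algebra_simps)
    also have "\<dots> \<le> norm (D N chi * A chi - P N chi) + norm ((L chi - D N chi) * A chi) + norm (E chi - P N chi)"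
      by (intro order_trans[OF norm_triangle_ineq4] add_right_mono norm_triangle_ineq)
    also have "\<dots> \<le> norm (D N chi * A chi - P N chi) + norm (L chi - D N chi) * real y + norm (E chi - P N chi)"
      unfolding norm_mult by (intro add_mono order_refl mult_left_mono A_le chi) auto
    finally show "norm (L chi * A chi - E chi) \<le> norm (D N chi * A chi - P N chi) + norm (L chi - D N chi) * real y + norm (E chi - P N chi)" .
  qed auto
  also have "\<dots> \<le> L2_set (\<lambda>chi. norm (D N chi * A chi - P N chi)) ?X + L2_set (\<lambda>chi. norm (L chi - D N chi) * real y) ?X
      + L2_set (\<lambda>chi. norm (E chi - P N chi)) ?X"
    by (intro order_trans[OF L2_set_triangle_ineq] add_right_mono L2_set_triangle_ineq)
  also have "L2_set (\<lambda>chi. norm (L chi - D N chi) * real y) ?X = L2_set (\<lambda>chi. norm (L chi - D N chi)) ?X * real y"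
    by (simp add: L2_set_left_distrib)
  also have "\<dots> \<le> 2 * real q * real (Suc N) powr (-s) * real y"
    by (intro mult_right_mono D_tail) auto
  also have "L2_set (\<lambda>chi. norm (D N chi * A chi - P N chi)) ?X
     \<le> sqrt (real q * (\<Sum>k\<in>{y<..y * N}. 4 * (h k)\<^sup>2 * real k powr (-(2 * s))))"
    unfolding D_def A_def P_def by (rule dirichlet_polynomial_product_mean_square[OF y conv h])
  also note P_tail
  finally show ?thesis unfolding L_def A_def by (simp add: algebra_simps)
qed

end

section \<open>Elementary estimates for floors and logarithms\<close>

lemma nat_floor_bounds:
  assumes "x \<ge> (0::real)"
  shows   "real (nat \<lfloor>x\<rfloor>) \<le> x" "x \<le> real (nat \<lfloor>x\<rfloor>) + 1"
  using assms by linarith+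

lemma ln_le_sqrt_powr:
  assumes "x > (0::real)"
  shows   "ln x \<le> x powr (1 / 2)"
proof -
  \<comment> \<open>With the fourth root \<open>t\<close> the claim reduces to
    \<open>4 * (t - 1) \<le> t * t\<close>, that is, to a square being nonnegative.\<close>
  define t where "t = x powr (1 / 4)"
  have t: "t > 0" "t * t = x powr (1 / 2)"
    using assms by (auto simp: t_def simp flip: powr_add)
  have "ln x = 4 * ln t" using assms by (simp add: t_def ln_powr)
  also have "\<dots> \<le> 4 * (t - 1)" using ln_le_minus_one[OF t(1)] by simp
  also have "\<dots> \<le> t * t" using zero_le_power2[of "t - 2"] by (simp add: power2_eq_square algebra_simps)
  finally show ?thesis unfolding t(2) .
qed

lemma ln_ge_2:
  assumes "x \<ge> (9::real)"
  shows   "ln x \<ge> 2"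
proof -
  have "exp 2 = exp 1 * exp (1::real)" by (simp flip: exp_add)
  also have "\<dots> \<le> 3 * 3" by (intro mult_mono exp_le) auto
  finally show ?thesis using assms by (subst ln_ge_iff) auto
qed

text \<open>The derivative has the sign of \<open>1 - s * ln t\<close>, which is at most 0 once
  \<open>ln t \<ge> 2\<close>. This is the source of the threshold 9.\<close>

lemma ln_times_powr_decreasing:
  fixes s :: real
  assumes "s \<ge> 1 / 2" "9 \<le> x" "x \<le> y"
  shows   "ln y * y powr (-s) \<le> ln x * x powr (-s)"
proof (rule DERIV_nonpos_imp_nonincreasing[OF assms(3), of "\<lambda>x. ln x * x powr (-s)"])
  fix t assume t: "x \<le> t" "t \<le> y"
  have "((\<lambda>x. ln x * x powr (-s)) has_real_derivative (1 - s * ln t) * t powr (-s - 1)) (at t)"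
    using t assms by (auto intro!: derivative_eq_intros simp: powr_diff field_simps)
  moreover have "s * ln t \<ge> (1 / 2) * 2"
    using ln_ge_2[of t] t assms by (intro mult_mono) auto
  hence "(1 - s * ln t) * t powr (-s - 1) \<le> 0"
    by (intro mult_nonpos_nonneg) auto
  ultimately show "\<exists>y. ((\<lambda>x. ln x * x powr (-s)) has_real_derivative y) (at t) \<and> y \<le> 0" by blast
qed

text \<open>Chooses the lengths so that both error terms save a power of \<open>q\<close> against
  \<open>q powr (1 / 2)\<close>, the size of a constant in this norm. The conditions on
  \<open>e\<close> from 9 onwards fit the indicator of 1 as well as \<open>ln\<close>, the divisor
  sums of \<open>moebius\<close> and \<open>mangoldt\<close>.\<close>

lemma dirichlet_L_mollified_asymptotic:
  fixes a e h :: "nat \<Rightarrow> real" and E :: "(nat \<Rightarrow> complex) \<Rightarrow> complex" and s w K :: real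
  assumes s: "1 / 2 < s" "s < 1" and w: "w = 2 * s - 1"
    and conv: "\<And>k. k > 0 \<Longrightarrow> (\<Sum>d | d dvd k. a d) = e k"
    and h: "\<And>k. k > 0 \<Longrightarrow> (\<Sum>d | d dvd k. \<bar>a d\<bar>) \<le> h k"
    and a_le: "\<And>d. d > 0 \<Longrightarrow> \<bar>a d\<bar> \<le> real d powr (1 / 2)"
    and e_nonneg: "\<And>k. k \<ge> 9 \<Longrightarrow> e k \<ge> 0"
    and e_anti: "\<And>k. k \<ge> 9 \<Longrightarrow> e (Suc k) * real (Suc k) powr (-s) \<le> e k * real k powr (-s)"
    and e_le: "\<And>k. k \<ge> 9 \<Longrightarrow> e k \<le> ln (real k)"
    and K: "\<And>X. (\<Sum>k\<in>{1..X}. (h k)\<^sup>2 * real k powr (-(1 + w / 2))) \<le> K"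
    and E: "\<And>q chi. prime q \<Longrightarrow> chi \<in> nonprincipal_chars q \<Longrightarrow>
               (\<lambda>M. \<Sum>k\<in>{1..M}. of_real (e k * real k powr (-s)) * chi k) \<longlonglongrightarrow> E chi"
  shows "\<exists>C. \<forall>\<^sub>F q in sequentially. prime q \<longrightarrow>
     L2_set (\<lambda>chi. norm (dirichlet_L chi (of_real s) *
         (\<Sum>d\<in>{1..nat \<lfloor>real q powr (w / 8)\<rfloor>}. of_real (a d * real d powr (-s)) * chi d) - E chi)) (nonprincipal_chars q)
       \<le> C * real q powr (1 / 2 - w\<^sup>2 / 32)"
proof (intro exI)
  define d where "d = w / 8"
  have w01: "w > 0" "w < 1" and d01: "d > 0" "d < 1 / 8" using s by (auto simp: w d_def)
  have K0: "K \<ge> 0" using K[of 0] by simp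
  have ev: "eventually (\<lambda>q::nat. real q powr d \<ge> 1) sequentially"
     "eventually (\<lambda>q::nat. real q powr (1 - d) / 2 \<ge> 10) sequentially"
     "eventually (\<lambda>q::nat. real q powr (1 - d) / 2 \<ge> real q powr d + 1) sequentially"
     "eventually (\<lambda>q::nat. ln (real q) \<le> real q powr d) sequentially"
     "eventually (\<lambda>q::nat. q > 1) sequentially"
    using d01 by real_asymp+
  show "\<forall>\<^sub>F q in sequentially. prime q \<longrightarrow>
     L2_set (\<lambda>chi. norm (dirichlet_L chi (of_real s) *
         (\<Sum>d\<in>{1..nat \<lfloor>real q powr (w / 8)\<rfloor>}. of_real (a d * real d powr (-s)) * chi d) - E chi)) (nonprincipal_chars q)
       \<le> (2 * sqrt K + 8) * real q powr (1 / 2 - w\<^sup>2 / 32)"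
    using ev
  proof eventually_elim
    case (elim q)
    show ?case
    proof
      assume pq: "prime q"
      define Q where "Q = real q"
      have Q: "Q > 1" using elim by (simp add: Q_def)
      \<comment> \<open>The product of the two lengths is at most \<open>Q / 2\<close>, hence below
        \<open>q\<close>. At the same time \<open>N\<close> is close enough to \<open>q\<close> for
        small tails, and \<open>y\<close> is large enough for the sum over \<open>k > y\<close> to
        be small.\<close>
      define y where "y = nat \<lfloor>Q powr d\<rfloor>"
      define N where "N = nat \<lfloor>Q powr (1 - d) / 2\<rfloor>"
      have y_bounds: "real y \<le> Q powr d" "Q powr d \<le> real y + 1"
        unfolding y_def by (rule nat_floor_bounds, simp)+
      have N_bounds: "real N \<le> Q powr (1 - d) / 2" "Q powr (1 - d) / 2 \<le> real N + 1"
        unfolding N_def by (rule nat_floor_bounds, simp)+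
      have y0: "0 < y" using elim(1) by (simp add: y_def Q_def le_floor_iff)
      have N9: "N \<ge> 9" using N_bounds(2) elim(2) unfolding Q_def by linarith
      have yN: "y \<le> N" using N_bounds(2) y_bounds(1) elim(3) unfolding Q_def by linarith
      have "real y * real N \<le> Q powr d * (Q powr (1 - d) / 2)"
        by (intro mult_mono y_bounds N_bounds) auto
      also have "\<dots> = Q / 2" using Q by (simp flip: powr_add)
      also have "\<dots> < Q" using Q by simp
      finally have yNq: "y * N < q" unfolding Q_def by (simp flip: of_nat_mult)
      have "N \<le> y * N" using y0 by simp
      hence N1q: "Suc N \<le> q" using yNq by linarith
      have "L2_set (\<lambda>chi. norm (dirichlet_L chi (of_real s) *
           (\<Sum>d\<in>{1..y}. of_real (a d * real d powr (-s)) * chi d) - E chi)) (nonprincipal_chars q)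
         \<le> sqrt (real q * (\<Sum>k\<in>{y<..y * N}. 4 * (h k)\<^sup>2 * real k powr (-(2 * s))))
           + 2 * real q * (real y + e (Suc N)) * real (Suc N) powr (-s)"
        by (rule dirichlet_L_mollified_mean_square[OF pq _ _ y0 yN yNq conv h a_le])
           (use s N9 e_nonneg e_anti E[OF pq] in auto)
      also have "sqrt (real q * (\<Sum>k\<in>{y<..y * N}. 4 * (h k)\<^sup>2 * real k powr (-(2 * s)))) \<le>
        2 * sqrt K * Q powr (1 / 2 - w\<^sup>2 / 32)"
      proof -
        have "(\<Sum>k\<in>{y<..y * N}. 4 * (h k)\<^sup>2 * real k powr (-(2 * s)))
           \<le> (\<Sum>k\<in>{y<..y * N}. 4 * Q powr (- (w\<^sup>2 / 16)) * ((h k)\<^sup>2 * real k powr (-(1 + w / 2))))"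
        proof (rule sum_mono)
          fix k assume k: "k \<in> {y<..y * N}"
          \<comment> \<open>From \<open>k > y\<close> one gets \<open>k \<ge> y + 1\<close>, which
            makes up for the floor. Then \<open>2 * s = w / 2 + (1 + w / 2)\<close>: the first part
            of the exponent yields the saving, the second keeps the sum bounded by
            \<open>K\<close>.\<close>
          have "Q powr d \<le> real k" using k y_bounds(2) by auto
          hence "real k powr (- (w / 2)) \<le> (Q powr d) powr (- (w / 2))"
            using w01 Q by (intro powr_mono2') auto
          also have "\<dots> = Q powr (- (w\<^sup>2 / 16))"
            by (simp add: powr_powr d_def power2_eq_square)
          finally have "real k powr (- (w / 2)) * real k powr (-(1 + w / 2)) \<le> Q powr (- (w\<^sup>2 / 16)) * real k powr (-(1 + w / 2))"
            by (intro mult_right_mono) auto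
          hence "real k powr (-(2 * s)) \<le> Q powr (- (w\<^sup>2 / 16)) * real k powr (-(1 + w / 2))"
            by (simp add: w flip: powr_add)
          from mult_left_mono[OF this, of "4 * (h k)\<^sup>2"]
          show "4 * (h k)\<^sup>2 * real k powr (-(2 * s)) \<le> 4 * Q powr (- (w\<^sup>2 / 16)) * ((h k)\<^sup>2 * real k powr (-(1 + w / 2)))"
            by (simp add: mult_ac)
        qed
        also have "\<dots> = 4 * Q powr (- (w\<^sup>2 / 16)) * (\<Sum>k\<in>{y<..y * N}. (h k)\<^sup>2 * real k powr (-(1 + w / 2)))"
          by (rule sum_distrib_left [symmetric])
        also have "\<dots> \<le> 4 * Q powr (- (w\<^sup>2 / 16)) * (\<Sum>k\<in>{1..y * N}. (h k)\<^sup>2 * real k powr (-(1 + w / 2)))"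
          by (intro mult_left_mono sum_mono2) auto
        also have "\<dots> \<le> 4 * Q powr (- (w\<^sup>2 / 16)) * K"
          by (intro mult_left_mono K) auto
        finally have "sqrt (real q * (\<Sum>k\<in>{y<..y * N}. 4 * (h k)\<^sup>2 * real k powr (-(2 * s))))
            \<le> sqrt (Q * (4 * Q powr (- (w\<^sup>2 / 16)) * K))"
          unfolding Q_def by (intro real_sqrt_le_mono mult_left_mono) auto
        also have "Q * (4 * Q powr (- (w\<^sup>2 / 16)) * K) = (2 * sqrt K * Q powr (1 / 2 - w\<^sup>2 / 32))\<^sup>2"
        proof -
          have "(Q powr (1 / 2 - w\<^sup>2 / 32))\<^sup>2 = Q powr (1 - w\<^sup>2 / 16)"
            by (simp add: power2_eq_square flip: powr_add)
          also have "\<dots> = Q * Q powr (- (w\<^sup>2 / 16))"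
            using Q powr_add[of Q 1 "- (w\<^sup>2 / 16)"] by simp
          finally show ?thesis using K0 by (simp add: power_mult_distrib)
        qed
        also have "sqrt \<dots> = 2 * sqrt K * Q powr (1 / 2 - w\<^sup>2 / 32)"
          using K0 by simp
        finally show ?thesis .
      qed
      also have "2 * real q * (real y + e (Suc N)) * real (Suc N) powr (-s) \<le> 8 * Q powr (1 / 2 - w\<^sup>2 / 32)"
      proof -
        have "e (Suc N) \<le> ln (real (Suc N))" using N9 by (intro e_le) auto
        also have "\<dots> \<le> ln Q" using N1q Q unfolding Q_def by (subst ln_le_cancel_iff) auto
        also have "\<dots> \<le> Q powr d" using elim unfolding Q_def by simp
        finally have e: "e (Suc N) \<le> Q powr d" .
        have e0: "e (Suc N) \<ge> 0" using N9 by (intro e_nonneg) auto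
        have "real (Suc N) powr (-s) \<le> (Q powr (1 - d) / 2) powr (-s)"
          using s N_bounds Q by (intro powr_mono2') auto
        also have "\<dots> = Q powr ((1 - d) * (-s)) / 2 powr (-s)"
          using Q by (simp add: powr_divide powr_powr)
        also have "\<dots> = 2 powr s * Q powr (- s + s * d)"
          by (simp add: powr_minus_divide algebra_simps)
        also have "\<dots> \<le> 2 powr 1 * Q powr (- s + d)"
          using s d01 Q by (intro mult_mono powr_mono) auto
        finally have N: "real (Suc N) powr (-s) \<le> 2 * Q powr (- s + d)" by simp
        have "2 * real q * (real y + e (Suc N)) * real (Suc N) powr (-s)
          \<le> 2 * Q * (Q powr d + Q powr d) * (2 * Q powr (- s + d))"
          unfolding Q_def [symmetric] using Q e0 by (intro mult_mono N add_mono y_bounds e order_refl) auto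
        also have "\<dots> = 8 * (Q powr 1 * Q powr d * Q powr (- s + d))"
          using Q by simp
        \<comment> \<open>The exponent is \<open>1 + d - s + d\<close> with
          \<open>s = (1 + w) / 2\<close> and \<open>d = w / 8\<close>.\<close>
        also have "Q powr 1 * Q powr d * Q powr (- s + d) = Q powr (1 / 2 - w / 4)"
          unfolding powr_add [symmetric] by (rule arg_cong[where f = "\<lambda>x. Q powr x"]) (simp add: d_def w field_simps)
        also have "8 * \<dots> \<le> 8 * Q powr (1 / 2 - w\<^sup>2 / 32)"
        proof -
          have "w\<^sup>2 \<le> w" using w01 by (simp add: power2_eq_square mult_left_le)
          thus ?thesis using Q w01 by (intro mult_left_mono powr_mono) auto
        qed
        finally show ?thesis .
      qed
      finally show "L2_set (\<lambda>chi. norm (dirichlet_L chi (of_real s) *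
           (\<Sum>d\<in>{1..nat \<lfloor>real q powr (w / 8)\<rfloor>}. of_real (a d * real d powr (-s)) * chi d) - E chi)) (nonprincipal_chars q)
         \<le> (2 * sqrt K + 8) * real q powr (1 / 2 - w\<^sup>2 / 32)" unfolding Q_def y_def d_def by (simp add: algebra_simps)
    qed
  qed
qed

subsection \<open>Exceptional characters\<close>

definition mangoldt_poly :: "real \<Rightarrow> nat \<Rightarrow> (nat \<Rightarrow> complex) \<Rightarrow> complex" where
  "mangoldt_poly s y chi = (\<Sum>n\<in>{1..y}. of_real (mangoldt n * real n powr (-s)) * chi n)"

definition moebius_poly :: "real \<Rightarrow> nat \<Rightarrow> (nat \<Rightarrow> complex) \<Rightarrow> complex" where
  "moebius_poly s y chi = (\<Sum>n\<in>{1..y}. of_real (moebius n * real n powr (-s)) * chi n)"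

text \<open>The exponent is the \<open>w / 8\<close> of
  \<open>dirichlet_L_mollified_asymptotic\<close>, with \<open>w = 2 * s - 1\<close>.\<close>

definition poly_length :: "real \<Rightarrow> nat \<Rightarrow> nat" where
  "poly_length s q = nat \<lfloor>real q powr ((2 * s - 1) / 8)\<rfloor>"

lemma mangoldt_le_sqrt_powr:
  assumes "d > 0"
  shows   "\<bar>mangoldt d :: real\<bar> \<le> real d powr (1 / 2)"
  using mangoldt_le[OF assms] ln_le_sqrt_powr[of "real d"] assms mangoldt_nonneg[of d] by linarith

text \<open>The divisor sums of \<open>moebius\<close> vanish except at 1, so \<open>E\<close> is
  the constant 1 and the polynomial is an approximate inverse of the L-value. The majorant
  \<open>h\<close> is the divisor function.\<close>

lemma moebius_mollified_asymptotic:
  assumes s: "1 / 2 < s" "s < 1"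
  shows "\<exists>C. \<forall>\<^sub>F q in sequentially. prime q \<longrightarrow>
     L2_set (\<lambda>chi. norm (dirichlet_L chi (of_real s) * moebius_poly s (poly_length s q) chi - 1)) (nonprincipal_chars q)
       \<le> C * real q powr (1 / 2 - (2 * s - 1)\<^sup>2 / 32)"
proof -
  have "1 + (2 * s - 1) / 2 > 1" using s by simp
  then obtain K where K: "\<And>X. (\<Sum>n\<in>{1..X}. (real (card {d. d dvd n}))\<^sup>2 * real n powr (-(1 + (2 * s - 1) / 2))) \<le> K"
    using sum_card_divisors_sq_bounded by blast
  show ?thesis unfolding moebius_poly_def poly_length_def
  proof (rule dirichlet_L_mollified_asymptotic[OF s refl _ _ _ _ _ _ K, where e = "\<lambda>n. if n = 1 then 1 else 0"])
    fix k :: nat assume "k > 0"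
    thus "(\<Sum>d | d dvd k. moebius d) = (if k = 1 then 1 else 0)" by (rule sum_moebius_divisors)
    have "(\<Sum>d | d dvd k. \<bar>moebius d\<bar>) \<le> (\<Sum>d | d dvd k. 1)" by (intro sum_mono abs_moebius_le)
    thus "(\<Sum>d | d dvd k. \<bar>moebius d\<bar>) \<le> real (card {d. d dvd k})" by simp
    show "\<bar>moebius k\<bar> \<le> real k powr (1 / 2)"
      using \<open>k > 0\<close> by (intro order_trans[OF abs_moebius_le] ge_one_powr_ge_zero) auto
  next
    fix q chi assume q: "prime q" and chi: "chi \<in> nonprincipal_chars q"
    hence dc: "dirichlet_char q chi" by (simp add: nonprincipal_chars_def)
    show "(\<lambda>M. \<Sum>k\<in>{1..M}. of_real ((if k = 1 then 1 else 0) * real k powr (-s)) * chi k) \<longlonglongrightarrow> 1"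
    proof (rule tendsto_eventually, rule eventually_sequentiallyI[of 1])
      fix M :: nat assume "M \<ge> 1"
      hence "(\<Sum>k\<in>{1..M}. of_real ((if k = 1 then 1 else 0) * real k powr (-s)) * chi k) =
          (\<Sum>k\<in>{1}. of_real ((if k = 1 then 1 else 0) * real k powr (-s)) * chi k)"
        by (intro sum.mono_neutral_right) auto
      thus "(\<Sum>k\<in>{1..M}. of_real ((if k = 1 then 1 else 0) * real k powr (-s)) * chi k) = 1"
        using dc by simp
    qed
  qed auto
qed

text \<open>The divisor sums of \<open>mangoldt\<close> are \<open>ln\<close>, so \<open>E\<close>
  is minus the derivative of the L-function, and \<open>ln\<close> also serves as the majorant
  \<open>h\<close>.\<close>

lemma mangoldt_mollified_asymptotic:
  assumes s: "1 / 2 < s" "s < 1"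
  shows "\<exists>C. \<forall>\<^sub>F q in sequentially. prime q \<longrightarrow>
     L2_set (\<lambda>chi. norm (dirichlet_L chi (of_real s) * mangoldt_poly s (poly_length s q) chi - (- deriv (dirichlet_L chi) (of_real s)))) (nonprincipal_chars q)
       \<le> C * real q powr (1 / 2 - (2 * s - 1)\<^sup>2 / 32)"
proof -
  have "1 + (2 * s - 1) / 2 > 1" using s by simp
  then obtain K where K: "\<And>X. (\<Sum>n\<in>{1..X}. (ln (real n))\<^sup>2 * real n powr (-(1 + (2 * s - 1) / 2))) \<le> K"
    using sum_ln_sq_bounded by blast
  show ?thesis unfolding mangoldt_poly_def poly_length_def
  proof (rule dirichlet_L_mollified_asymptotic[OF s refl _ _ _ _ _ _ K])
    fix k :: nat assume k: "k > 0"
    thus "(\<Sum>d | d dvd k. mangoldt d) = ln (real k)" using mangoldt_sum[of k, where ?'a = real] by simp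
    thus "(\<Sum>d | d dvd k. \<bar>mangoldt d\<bar>) \<le> ln (real k)" by simp
    show "\<bar>mangoldt k :: real\<bar> \<le> real k powr (1 / 2)" using k by (rule mangoldt_le_sqrt_powr)
  next
    fix k :: nat assume "k \<ge> 9"
    thus "ln (real (Suc k)) * real (Suc k) powr (-s) \<le> ln (real k) * real k powr (-s)"
      using s by (intro ln_times_powr_decreasing) auto
  next
    fix q chi assume q: "prime q" and chi: "chi \<in> nonprincipal_chars q"
    show "(\<lambda>M. \<Sum>k\<in>{1..M}. of_real (ln (real k) * real k powr (-s)) * chi k) \<longlonglongrightarrow> - deriv (dirichlet_L chi) (of_real s)"
      using s by (intro deriv_dirichlet_L_tendsto[OF q chi]) auto
  qed auto
qed

lemma poly_length_less:
  assumes "1 / 2 < s" "s < 1"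
  shows "\<forall>\<^sub>F q in sequentially. poly_length s q < q"
proof -
  have "\<forall>\<^sub>F q :: nat in sequentially. real q powr ((2 * s - 1) / 8) < real q"
    using assms by real_asymp
  thus ?thesis
  proof eventually_elim
    case (elim q)
    have "real (poly_length s q) \<le> real q powr ((2 * s - 1) / 8)"
      unfolding poly_length_def by (rule nat_floor_bounds) simp
    thus ?case using elim by linarith
  qed
qed

section \<open>Mean squares of the two polynomials and the number of exceptional characters\<close>

lemma L2_moebius_poly_le:
  assumes "1 / 2 < s"
  obtains K where "K \<ge> 0" "\<And>q y X. prime q \<Longrightarrow> y < q \<Longrightarrow> X \<subseteq> {chi. dirichlet_char q chi} \<Longrightarrow>
            L2_set (\<lambda>chi. norm (moebius_poly s y chi)) X \<le> K * real q powr (1 / 2)"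
proof -
  obtain K where K: "\<And>X. (\<Sum>n\<in>{1..X}. real n powr (-(2 * s))) \<le> K"
    using sum_powr_bounded[of "2 * s"] assms by auto
  have K0: "K \<ge> 0" using K[of 0] by simp
  show ?thesis
  proof
    fix q y X assume q: "prime q" and y: "y < q" and X: "X \<subseteq> {chi. dirichlet_char q chi}"
    have "L2_set (\<lambda>chi. norm (moebius_poly s y chi)) X \<le> sqrt (real q * (\<Sum>n\<in>{1..y}. (moebius n * real n powr (-s))\<^sup>2))"
      unfolding moebius_poly_def using y by (intro L2_char_sum_le q X) auto
    also have "(\<Sum>n\<in>{1..y}. (moebius n * real n powr (-s))\<^sup>2) \<le> (\<Sum>n\<in>{1..y}. real n powr (-(2 * s)))"
    proof (rule sum_mono)
      fix n :: nat
      have "(moebius n)\<^sup>2 \<le> 1" using abs_moebius_le[of n] by (simp add: abs_square_le_1)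
      moreover have "(real n powr (-s))\<^sup>2 = real n powr (-(2 * s))" by (simp add: power2_eq_square flip: powr_add)
      ultimately show "(moebius n * real n powr (-s))\<^sup>2 \<le> real n powr (-(2 * s))"
        by (simp add: power_mult_distrib mult_left_le_one_le)
    qed
    also have "\<dots> \<le> K" by (rule K)
    finally have "L2_set (\<lambda>chi. norm (moebius_poly s y chi)) X \<le> sqrt (real q * K)"
      by (simp add: mult_left_mono)
    thus "L2_set (\<lambda>chi. norm (moebius_poly s y chi)) X \<le> sqrt K * real q powr (1 / 2)"
      by (simp add: real_sqrt_mult powr_half_sqrt mult.commute)
  qed (use K0 in auto)
qed

lemma L2_mangoldt_poly_le:
  assumes "1 / 2 < s"
  obtains K where "K \<ge> 0" "\<And>q y X. prime q \<Longrightarrow> y < q \<Longrightarrow> X \<subseteq> {chi. dirichlet_char q chi} \<Longrightarrow>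
            L2_set (\<lambda>chi. norm (mangoldt_poly s y chi)) X \<le> K * real q powr (1 / 2)"
proof -
  obtain K where K: "\<And>X. (\<Sum>n\<in>{1..X}. (ln (real n))\<^sup>2 * real n powr (-(2 * s))) \<le> K"
    using sum_ln_sq_bounded[of "2 * s"] assms by auto
  have K0: "K \<ge> 0" using K[of 0] by simp
  show ?thesis
  proof
    fix q y X assume q: "prime q" and y: "y < q" and X: "X \<subseteq> {chi. dirichlet_char q chi}"
    have "L2_set (\<lambda>chi. norm (mangoldt_poly s y chi)) X \<le> sqrt (real q * (\<Sum>n\<in>{1..y}. (mangoldt n * real n powr (-s))\<^sup>2))"
      unfolding mangoldt_poly_def using y by (intro L2_char_sum_le q X) auto
    also have "(\<Sum>n\<in>{1..y}. (mangoldt n * real n powr (-s))\<^sup>2) \<le> (\<Sum>n\<in>{1..y}. (ln (real n))\<^sup>2 * real n powr (-(2 * s)))"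
    proof (rule sum_mono)
      fix n assume n: "n \<in> {1..y}"
      have "(mangoldt n)\<^sup>2 \<le> (ln (real n))\<^sup>2" using mangoldt_le[of n] n by (intro power_mono mangoldt_nonneg) auto
      moreover have "(real n powr (-s))\<^sup>2 = real n powr (-(2 * s))" by (simp add: power2_eq_square flip: powr_add)
      ultimately show "(mangoldt n * real n powr (-s))\<^sup>2 \<le> (ln (real n))\<^sup>2 * real n powr (-(2 * s))"
        by (simp add: power_mult_distrib mult_right_mono)
    qed
    also have "\<dots> \<le> K" by (rule K)
    finally have "L2_set (\<lambda>chi. norm (mangoldt_poly s y chi)) X \<le> sqrt (real q * K)"
      by (simp add: mult_left_mono)
    thus "L2_set (\<lambda>chi. norm (mangoldt_poly s y chi)) X \<le> sqrt K * real q powr (1 / 2)"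
      by (simp add: real_sqrt_mult powr_half_sqrt mult.commute)
  qed (use K0 in auto)
qed

text \<open>A non-principal character with L-value 0 has \<open>log_deriv_L\<close> equal to 0, so
  it belongs to this set exactly if its polynomial exceeds 1 in norm.\<close>

definition bad_chars :: "real \<Rightarrow> nat \<Rightarrow> (nat \<Rightarrow> complex) set" where
  "bad_chars s q = {chi \<in> nonprincipal_chars q.
      norm (log_deriv_L chi (of_real s) + mangoldt_poly s (poly_length s q) chi) > 1}"

text \<open>If the right side were below 1, \<open>L * M\<close> would be within 1/2 of 1, so
  \<open>L\<close> would be nonzero, and \<open>L' / L + P = (L * P + L') * M / (L * M)\<close>
  would have norm at most 1. If \<open>L = 0\<close>, the first term alone is 4. The second term is
  a product, ready for Cauchy-Schwarz.\<close>

lemma bad_char_large: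
  assumes "norm (log_deriv_L chi (of_real s) + P) > 1"
  defines "L \<equiv> dirichlet_L chi (of_real s)" and "L' \<equiv> deriv (dirichlet_L chi) (of_real s)"
  shows   "1 \<le> 4 * (norm (L * M - 1))\<^sup>2 + 2 * (norm (L * P - (- L')) * norm M)"
proof (rule ccontr)
  assume "\<not> ?thesis"
  hence *: "4 * (norm (L * M - 1))\<^sup>2 + 2 * (norm (L * P + L') * norm M) < 1" by simp
  have nonneg: "norm (L * P + L') * norm M \<ge> 0" "(norm (L * M - 1))\<^sup>2 \<ge> 0" by simp_all
  hence "(norm (L * M - 1))\<^sup>2 < 1 / 4" using * by linarith
  hence "(norm (L * M - 1))\<^sup>2 < (1 / 2)\<^sup>2" by (simp add: power2_eq_square)
  hence 1: "norm (L * M - 1) < 1 / 2" by (rule power2_less_imp_less) simp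
  have 2: "norm (L * P + L') * norm M < 1 / 2" using * nonneg by linarith
  have "1 = norm (L * M - (L * M - 1))" by simp
  also have "\<dots> \<le> norm (L * M) + norm (L * M - 1)" by (rule norm_triangle_ineq4)
  finally have 3: "norm (L * M) > 1 / 2" using 1 by linarith
  hence nz: "L \<noteq> 0" "M \<noteq> 0" by auto
  have "log_deriv_L chi (of_real s) + P = (L * P + L') * M / (L * M)"
    unfolding log_deriv_L_def L_def [symmetric] L'_def [symmetric] using nz by (simp add: field_simps)
  also have "norm \<dots> = norm (L * P + L') * norm M / norm (L * M)"
    by (simp add: norm_mult norm_divide)
  also have "\<dots> \<le> 1" using 2 3 nz by (subst divide_le_eq_1) auto
  finally show False using assms by linarith
qed

text \<open>A Chebyshev-type count: \<open>bad_char_large\<close> is summed over the exceptional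
  characters and the sum is extended to all non-principal ones. The first term is a mean square, the
  second is treated by Cauchy-Schwarz, and both save at least \<open>q powr t\<close>.\<close>

lemma card_bad_chars_le:
  assumes s: "1 / 2 < s" "s < 1"
  shows "\<exists>C. \<forall>\<^sub>F q in sequentially. prime q \<longrightarrow>
           real (card (bad_chars s q)) \<le> C * real q powr (1 - (2 * s - 1)\<^sup>2 / 32)"
proof -
  define t where "t = (2 * s - 1)\<^sup>2 / 32"
  have t: "t > 0" using s by (simp add: t_def)
  obtain C1 where C1: "\<forall>\<^sub>F q in sequentially. prime q \<longrightarrow>
     L2_set (\<lambda>chi. norm (dirichlet_L chi (of_real s) * moebius_poly s (poly_length s q) chi - 1)) (nonprincipal_chars q)
       \<le> C1 * real q powr (1 / 2 - t)"
    using moebius_mollified_asymptotic[OF s] unfolding t_def by blast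
  obtain C2 where C2: "\<forall>\<^sub>F q in sequentially. prime q \<longrightarrow>
     L2_set (\<lambda>chi. norm (dirichlet_L chi (of_real s) * mangoldt_poly s (poly_length s q) chi - (- deriv (dirichlet_L chi) (of_real s)))) (nonprincipal_chars q)
       \<le> C2 * real q powr (1 / 2 - t)"
    using mangoldt_mollified_asymptotic[OF s] unfolding t_def by blast
  obtain K where K: "K \<ge> 0" "\<And>q y X. prime q \<Longrightarrow> y < q \<Longrightarrow> X \<subseteq> {chi. dirichlet_char q chi} \<Longrightarrow>
            L2_set (\<lambda>chi. norm (moebius_poly s y chi)) X \<le> K * real q powr (1 / 2)"
    using L2_moebius_poly_le[OF s(1)] by metis
  have "\<forall>\<^sub>F q in sequentially. prime q \<longrightarrow> real (card (bad_chars s q)) \<le> (4 * C1\<^sup>2 + 2 * (C2 * K)) * real q powr (1 - t)"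
    using C1 C2 poly_length_less[OF s]
  proof eventually_elim
    case (elim q)
    show ?case
    proof
      assume q: "prime q"
      let ?X = "nonprincipal_chars q"
      define M where "M = moebius_poly s (poly_length s q)"
      define Z1 where "Z1 chi = norm (dirichlet_L chi (of_real s) * M chi - 1)" for chi
      define Z2 where "Z2 chi = norm (dirichlet_L chi (of_real s) * mangoldt_poly s (poly_length s q) chi - (- deriv (dirichlet_L chi) (of_real s)))" for chi
      have q1: "real q \<ge> 1" using prime_gt_0_nat[OF q] by simp
      have Z1: "L2_set Z1 ?X \<le> C1 * real q powr (1 / 2 - t)"
        using elim(1) q unfolding Z1_def [abs_def] M_def by blast
      have Z2: "L2_set Z2 ?X \<le> C2 * real q powr (1 / 2 - t)"
        using elim(2) q unfolding Z2_def [abs_def] by blast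
      have M: "L2_set (\<lambda>chi. norm (M chi)) ?X \<le> K * real q powr (1 / 2)"
        unfolding M_def by (rule K(2)[OF q elim(3) nonprincipal_chars_subset])
      have "real (card (bad_chars s q)) = (\<Sum>chi\<in>bad_chars s q. 1)" by simp
      also have "\<dots> \<le> (\<Sum>chi\<in>bad_chars s q. 4 * (Z1 chi)\<^sup>2 + 2 * (Z2 chi * norm (M chi)))"
        unfolding Z1_def Z2_def by (intro sum_mono bad_char_large) (simp add: bad_chars_def)
      also have "\<dots> \<le> (\<Sum>chi\<in>?X. 4 * (Z1 chi)\<^sup>2 + 2 * (Z2 chi * norm (M chi)))"
        by (intro sum_mono2 finite_nonprincipal_chars q) (auto simp: bad_chars_def Z2_def)
      also have "\<dots> = 4 * (\<Sum>chi\<in>?X. (Z1 chi)\<^sup>2) + 2 * (\<Sum>chi\<in>?X. Z2 chi * norm (M chi))"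
        by (simp add: sum.distrib sum_distrib_left)
      also have "(\<Sum>chi\<in>?X. (Z1 chi)\<^sup>2) = (L2_set Z1 ?X)\<^sup>2"
        unfolding L2_set_def by (simp add: sum_nonneg)
      also have "\<dots> \<le> (C1 * real q powr (1 / 2 - t))\<^sup>2"
        by (intro power_mono Z1) auto
      also have "\<dots> = C1\<^sup>2 * real q powr (1 - 2 * t)"
        by (simp add: power_mult_distrib power2_eq_square flip: powr_add)
      also have "\<dots> \<le> C1\<^sup>2 * real q powr (1 - t)"
        using q1 t by (intro mult_left_mono powr_mono) auto
      also have "(\<Sum>chi\<in>?X. Z2 chi * norm (M chi)) \<le> L2_set Z2 ?X * L2_set (\<lambda>chi. norm (M chi)) ?X"
        using L2_set_mult_ineq[of Z2 "\<lambda>chi. norm (M chi)" ?X] by (simp add: Z2_def)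
      also have "\<dots> \<le> (C2 * real q powr (1 / 2 - t)) * (K * real q powr (1 / 2))"
        by (intro mult_mono Z2 M order_trans[OF L2_set_nonneg Z2] L2_set_nonneg)
      also have "\<dots> = C2 * K * real q powr (1 - t)"
        by (simp add: mult_ac flip: powr_add)
      finally show "real (card (bad_chars s q)) \<le> (4 * C1\<^sup>2 + 2 * (C2 * K)) * real q powr (1 - t)"
        by (simp add: algebra_simps)
    qed
  qed
  thus ?thesis unfolding t_def by blast
qed

text \<open>Cauchy-Schwarz against the number of exceptional characters halves the saved exponent.
  The principal character is included because it occurs among the quotients in the final
  average.\<close>

lemma sum_norm_mangoldt_poly_bad_chars_le:
  assumes s: "1 / 2 < s" "s < 1"
  shows "\<exists>C. \<forall>\<^sub>F q in sequentially. prime q \<longrightarrow>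
           (\<Sum>chi\<in>insert (principal_char q) (bad_chars s q). norm (mangoldt_poly s (poly_length s q) chi))
              \<le> C * real q powr (1 - (2 * s - 1)\<^sup>2 / 64)"
proof -
  define t where "t = (2 * s - 1)\<^sup>2 / 32"
  have t: "t \<le> 1" using s power_le_one[of "2 * s - 1" 2] by (simp add: t_def)
  obtain C where C: "\<forall>\<^sub>F q in sequentially. prime q \<longrightarrow> real (card (bad_chars s q)) \<le> C * real q powr (1 - t)"
    using card_bad_chars_le[OF s] unfolding t_def by blast
  obtain K where K: "K \<ge> 0" "\<And>q y X. prime q \<Longrightarrow> y < q \<Longrightarrow> X \<subseteq> {chi. dirichlet_char q chi} \<Longrightarrow>
            L2_set (\<lambda>chi. norm (mangoldt_poly s y chi)) X \<le> K * real q powr (1 / 2)"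
    using L2_mangoldt_poly_le[OF s(1)] by metis
  have "\<forall>\<^sub>F q in sequentially. prime q \<longrightarrow>
           (\<Sum>chi\<in>insert (principal_char q) (bad_chars s q). norm (mangoldt_poly s (poly_length s q) chi))
              \<le> (sqrt (C + 1) * K) * real q powr (1 - t / 2)"
    using C poly_length_less[OF s]
  proof eventually_elim
    case (elim q)
    show ?case
    proof
      assume q: "prime q"
      let ?B = "insert (principal_char q) (bad_chars s q)"
      let ?P = "\<lambda>chi. norm (mangoldt_poly s (poly_length s q) chi)"
      have q1: "real q \<ge> 1" using prime_gt_0_nat[OF q] by simp
      have sub: "?B \<subseteq> {chi. dirichlet_char q chi}"
        using dirichlet_char_principal_char by (auto simp: bad_chars_def nonprincipal_chars_def)
      have fin: "finite (bad_chars s q)"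
        using finite_subset[OF _ finite_nonprincipal_chars[OF q]] by (auto simp: bad_chars_def)
      have "real (card ?B) \<le> real (card (bad_chars s q)) + 1"
        using card_insert_le_m1[of 1] fin by (simp add: card_insert_if)
      also have "\<dots> \<le> C * real q powr (1 - t) + 1 * real q powr (1 - t)"
        using elim(1) q q1 t ge_one_powr_ge_zero[of "real q" "1 - t"] by (intro add_mono) auto
      finally have card: "real (card ?B) \<le> (C + 1) * real q powr (1 - t)" by (simp add: algebra_simps)
      have "(\<Sum>chi\<in>?B. ?P chi) \<le> L2_set ?P ?B * L2_set (\<lambda>_. 1) ?B"
        using L2_set_mult_ineq[of ?P "\<lambda>_. 1" ?B] by simp
      also have "\<dots> \<le> (K * real q powr (1 / 2)) * sqrt (real (card ?B))"
        using K(2)[OF q elim(2) sub] K(1) by (intro mult_mono) (auto simp: L2_set_constant)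
      also have "\<dots> \<le> (K * real q powr (1 / 2)) * sqrt ((C + 1) * real q powr (1 - t))"
        by (intro mult_left_mono real_sqrt_le_mono card) (use K in auto)
      also have "sqrt ((C + 1) * real q powr (1 - t)) = sqrt (C + 1) * real q powr ((1 - t) / 2)"
        by (simp add: real_sqrt_mult powr_half_sqrt_powr)
      also have "(K * real q powr (1 / 2)) * (sqrt (C + 1) * real q powr ((1 - t) / 2)) =
         (sqrt (C + 1) * K) * (real q powr (1 / 2) * real q powr ((1 - t) / 2))"
        by (simp add: mult_ac)
      also have "real q powr (1 / 2) * real q powr ((1 - t) / 2) = real q powr (1 - t / 2)"
        by (simp add: diff_divide_distrib flip: powr_add)
      finally show "(\<Sum>chi\<in>?B. ?P chi) \<le> (sqrt (C + 1) * K) * real q powr (1 - t / 2)" .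
    qed
  qed
  moreover have "1 - t / 2 = 1 - (2 * s - 1)\<^sup>2 / 64" by (simp add: t_def)
  ultimately show ?thesis by metis
qed

subsection \<open>A lower bound for the number of primes\<close>

text \<open>Legendre's formula. From \<open>m\<close> to \<open>Suc m\<close> the quotient by
  \<open>d\<close> grows by 1 exactly when \<open>d\<close> divides \<open>Suc m\<close>, and the
  von Mangoldt function sums to \<open>ln (Suc m)\<close> over these divisors.\<close>

lemma sum_mangoldt_div_eq_ln_fact:
  "(\<Sum>d\<in>{1..m}. mangoldt d * real (m div d)) = ln (fact m)"
proof (induction m)
  case (Suc m)
  have "(\<Sum>d\<in>{1..Suc m}. mangoldt d * real (Suc m div d)) =
      (\<Sum>d\<in>{1..Suc m}. mangoldt d * real (m div d) + (if d dvd Suc m then mangoldt d else 0))"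
    by (intro sum.cong refl) (auto simp: div_Suc dvd_eq_mod_eq_0 algebra_simps)
  also have "\<dots> = (\<Sum>d\<in>{1..Suc m}. mangoldt d * real (m div d)) + (\<Sum>d\<in>{1..Suc m}. if d dvd Suc m then mangoldt d else 0)"
    by (rule sum.distrib)
  also have "(\<Sum>d\<in>{1..Suc m}. mangoldt d * real (m div d)) = ln (fact m)"
    using Suc by simp
  also have "(\<Sum>d\<in>{1..Suc m}. if d dvd Suc m then mangoldt d else 0) = (\<Sum>d | d dvd Suc m. mangoldt d :: real)"
    using dvd_imp_le[of _ "Suc m"] dvd_pos_nat[of "Suc m"]
    by (intro sum.mono_neutral_cong_right) (auto simp: Suc_le_eq)
  also have "\<dots> = ln (real (Suc m))" using mangoldt_sum[of "Suc m", where ?'a = real] by simp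
  also have "ln (fact m) + ln (real (Suc m)) = ln (fact (Suc m) :: real)"
    by (subst ln_mult_pos [symmetric]) (auto simp: mult.commute)
  finally show ?case .
qed simp

text \<open>Legendre's formula for the three factorials leaves the coefficient
  \<open>2 * n div d - 2 * (n div d)\<close>, which is at most 1.\<close>

lemma ln_central_binomial_le:
  assumes "n > 0"
  shows "ln (real ((2 * n) choose n)) \<le> (\<Sum>d\<in>{1..2 * n}. mangoldt d)"
proof -
  have "real ((2 * n) choose n) = fact (2 * n) / (fact n * fact n)"
    using binomial_fact[of n "2 * n", where ?'a = real] by simp
  hence "ln (real ((2 * n) choose n)) = ln (fact (2 * n)) - 2 * ln (fact n)"
    by (simp add: ln_div ln_mult_pos)
  also have "ln (fact n :: real) = (\<Sum>d\<in>{1..2 * n}. mangoldt d * real (n div d))"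
    unfolding sum_mangoldt_div_eq_ln_fact [symmetric] by (intro sum.mono_neutral_left) auto
  also have "ln (fact (2 * n) :: real) = (\<Sum>d\<in>{1..2 * n}. mangoldt d * real (2 * n div d))"
    unfolding sum_mangoldt_div_eq_ln_fact ..
  also have "\<dots> - 2 * (\<Sum>d\<in>{1..2 * n}. mangoldt d * real (n div d)) =
      (\<Sum>d\<in>{1..2 * n}. mangoldt d * (real (2 * n div d) - 2 * real (n div d)))"
    by (simp add: sum_distrib_left sum_subtractf algebra_simps)
  also have "\<dots> \<le> (\<Sum>d\<in>{1..2 * n}. mangoldt d * 1)"
  proof (intro sum_mono mult_left_mono mangoldt_nonneg)
    fix d assume d: "d \<in> {1..2 * n}"
    have "2 * n = 2 * (n div d) * d + 2 * (n mod d)"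
      by (metis div_mult_mod_eq add_mult_distrib2 mult.assoc)
    moreover have "n mod d < d" using d by simp
    ultimately have "2 * n < (2 * (n div d) + 2) * d" by (simp add: algebra_simps)
    hence "2 * n div d < 2 * (n div d) + 2" by (rule less_mult_imp_div_less)
    thus "real (2 * n div d) - 2 * real (n div d) \<le> 1" by linarith
  qed
  finally show ?thesis by simp
qed

text \<open>A prime \<open>p\<close> has at most \<open>ln m / ln p\<close> powers up to
  \<open>m\<close>, each of weight \<open>ln p\<close>, so it contributes at most
  \<open>ln m\<close>.\<close>

lemma sum_mangoldt_le_card_primes:
  assumes "m > 0"
  shows "(\<Sum>d\<in>{1..m}. mangoldt d) \<le> real (card {p. prime p \<and> p \<le> m}) * ln (real m)"
proof -
  let ?D = "{d\<in>{1..m}. primepow d}" and ?P = "{p. prime p \<and> p \<le> m}"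
  have "(\<Sum>d\<in>{1..m}. mangoldt d) = (\<Sum>d\<in>?D. ln (real (aprimedivisor d)))"
    by (intro sum.mono_neutral_cong_right) (auto simp: mangoldt_def)
  also have "\<dots> = (\<Sum>p\<in>?P. \<Sum>d\<in>{d\<in>?D. aprimedivisor d = p}. ln (real (aprimedivisor d)))"
  proof (rule sum.group [symmetric])
    show "aprimedivisor ` ?D \<subseteq> ?P"
    proof clarify
      fix d assume d: "d \<in> {1..m}" "primepow d"
      have "d > 1" using primepow_gt_Suc_0[OF d(2)] by simp
      thus "prime (aprimedivisor d) \<and> aprimedivisor d \<le> m"
        using d aprimedivisor_le_nat[of d] by (auto intro!: prime_aprimedivisor' simp: primepow_gt_0_nat)
    qed
  qed auto
  also have "\<dots> \<le> (\<Sum>p\<in>?P. ln (real m))"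
  proof (rule sum_mono)
    fix p assume p: "p \<in> ?P"
    hence p1: "p > 1" using prime_gt_1_nat by auto
    have lnp: "ln (real p) > 0" using p1 by simp
    let ?K = "nat \<lfloor>ln (real m) / ln (real p)\<rfloor>"
    have "{d\<in>?D. aprimedivisor d = p} \<subseteq> (\<lambda>k. p ^ k) ` {1..?K}"
    proof
      fix d assume d: "d \<in> {d\<in>?D. aprimedivisor d = p}"
      then obtain p' k where k: "prime p'" "k > 0" "d = p' ^ k" unfolding primepow_def by auto
      hence "p' = p" using d aprimedivisor_prime_power[of p' k] by simp
      hence dk: "d = p ^ k" using k by simp
      have "real k * ln (real p) = ln (real d)" using p1 by (simp add: dk ln_realpow)
      also have "\<dots> \<le> ln (real m)" using d by simp
      finally have "real k \<le> ln (real m) / ln (real p)" using lnp by (simp add: field_simps)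
      hence "k \<le> ?K" by (simp add: le_nat_floor)
      thus "d \<in> (\<lambda>k. p ^ k) ` {1..?K}" using dk k by auto
    qed
    hence "card {d\<in>?D. aprimedivisor d = p} \<le> ?K"
      using surj_card_le[of "{1..?K}"] by fastforce
    moreover have "real ?K \<le> ln (real m) / ln (real p)"
      using lnp assms by (intro nat_floor_bounds) simp
    ultimately have "real (card {d\<in>?D. aprimedivisor d = p}) \<le> ln (real m) / ln (real p)"
      by linarith
    hence "real (card {d\<in>?D. aprimedivisor d = p}) * ln (real p) \<le> ln (real m)"
      using lnp by (simp add: field_simps)
    thus "(\<Sum>d\<in>{d\<in>?D. aprimedivisor d = p}. ln (real (aprimedivisor d))) \<le> ln (real m)"
      by simp
  qed
  finally show ?thesis by simp
qed

text \<open>Chebyshev's lower bound, from the size of the central binomial coefficient.\<close>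

lemma card_primes_ge:
  fixes x :: real
  assumes x: "x \<ge> 8"
  shows "real (card {p. prime p \<and> real p \<le> x}) \<ge> x / (4 * ln x)"
proof -
  define n where "n = nat \<lfloor>x\<rfloor> div 2"
  have lnx: "ln x > 0" using x by simp
  have fl: "real (nat \<lfloor>x\<rfloor>) \<le> x" "x \<le> real (nat \<lfloor>x\<rfloor>) + 1"
    using nat_floor_bounds[of x] x by simp_all
  have "nat \<lfloor>x\<rfloor> \<le> 2 * n + 1" "2 * n \<le> nat \<lfloor>x\<rfloor>" unfolding n_def by linarith+
  hence n: "x \<le> 2 * real n + 2" "real (2 * n) \<le> x" using fl by linarith+
  have "real n > 0" using n x by linarith
  hence n0: "n > 0" by simp
  have fin: "finite {p :: nat. prime p \<and> real p \<le> x}"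
    by (rule finite_subset[of _ "{..nat \<lfloor>x\<rfloor>}"]) (auto intro: le_nat_floor)
  \<comment> \<open>Since \<open>n \<ge> (x - 2) / 2\<close>, this inequality follows from
    \<open>x \<ge> 8\<close>.\<close>
  have "x / 4 \<le> (2 / 3) * real n" using n x by linarith
  also have "\<dots> \<le> ln 2 * real n" using ln2_ge_two_thirds by (intro mult_right_mono) auto
  also have "\<dots> = ln (2 ^ n)" by (simp add: ln_realpow)
  also have "\<dots> \<le> ln (real ((2 * n) choose n))"
  proof -
    \<comment> \<open>This absorbs the denominator of \<open>4 ^ n / (2 * n)\<close>.\<close>
    have le: "2 * real m \<le> 2 ^ m" if "m > 0" for m
      using that by (induction m rule: nat_induct_non_zero) auto
    have "(2::real) ^ n * (2 * real n) \<le> 2 ^ n * 2 ^ n" by (intro mult_left_mono le n0) auto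
    also have "\<dots> = 4 ^ n" unfolding power_mult_distrib [symmetric] by simp
    finally have "(2::real) ^ n \<le> 4 ^ n / (2 * real n)" using n0 by (subst pos_le_divide_eq) simp_all
    also have "\<dots> \<le> real ((2 * n) choose n)" using central_binomial_lower_bound[OF n0] .
    finally show ?thesis by (intro ln_mono) simp_all
  qed
  also have "\<dots> \<le> (\<Sum>d\<in>{1..2 * n}. mangoldt d)" by (rule ln_central_binomial_le[OF n0])
  also have "\<dots> \<le> real (card {p. prime p \<and> p \<le> 2 * n}) * ln (real (2 * n))"
    using n0 by (intro sum_mangoldt_le_card_primes) simp
  also have "\<dots> \<le> real (card {p. prime p \<and> real p \<le> x}) * ln x"
  proof (intro mult_mono)
    show "real (card {p. prime p \<and> p \<le> 2 * n}) \<le> real (card {p. prime p \<and> real p \<le> x})"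
      unfolding of_nat_le_iff using n by (intro card_mono fin) auto
    show "ln (real (2 * n)) \<le> ln x" using n n0 x by simp
    show "0 \<le> ln (real (2 * n))" using n0 by simp
  qed auto
  finally have "x / 4 / ln x \<le> real (card {p. prime p \<and> real p \<le> x})"
    using lnx by (simp only: pos_divide_le_eq)
  thus ?thesis by simp
qed

text \<open>Chebyshev's bound supplies a small multiple of \<open>ln q\<close> primes up to a
  multiple of \<open>ln q * ln (ln q)\<close>, and each contributes at least the value of a
  decreasing function at the upper end. The cardinality is limited because each prime costs a factor
  8 in the pigeonhole argument.\<close>

lemma primes_with_large_sum:
  fixes s :: real
  assumes s: "1 / 2 < s" "s < 1"
  shows "\<forall>\<^sub>F q in sequentially. \<exists>S. finite S \<and> S \<subseteq> {p. prime p \<and> p \<le> poly_length s q} \<and>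
           real (card S) \<le> ((2 * s - 1) / 20)\<^sup>2 * ln (real q) \<and>
           (\<Sum>p\<in>S. ln (real p) * real p powr (-s)) \<ge>
             (2 * s - 1) / 1280 * (ln (real q) powr (1 - s) * ln (ln (real q)) powr (1 - s))"
proof -
  define w where "w = 2 * s - 1"
  \<comment> \<open>The 20 is fixed by the pigeonhole argument: as
    \<open>ln 8 \<le> 25 / 12\<close>, it yields
    \<open>8 ^ card S \<le> q powr (w ^ 2 / 192)\<close>, less than the saving
    \<open>q powr (w ^ 2 / 64)\<close> on the exceptional characters.\<close>
  define k where "k = (w / 20)\<^sup>2"
  have w: "w > 0" "w < 1" and k: "k > 0" using s by (auto simp: w_def k_def)
  \<comment> \<open>With the factor 16, \<open>card_primes_ge\<close> and
    \<open>ln (z q) \<le> 2 * ln (ln q)\<close> give at least \<open>2 * k * ln q\<close> primes up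
    to \<open>z q\<close>.\<close>
  define z where "z q = 16 * k * ln (real q) * ln (ln (real q))" for q
  have ev: "\<forall>\<^sub>F q in sequentially. z q \<ge> 100"
    "\<forall>\<^sub>F q in sequentially. ln (z q) \<ge> ln (ln (real q)) / 2"
    "\<forall>\<^sub>F q in sequentially. ln (z q) \<le> 2 * ln (ln (real q))"
    "\<forall>\<^sub>F q::nat in sequentially. k * ln (real q) \<ge> 10"
    "\<forall>\<^sub>F q in sequentially. z q + 1 \<le> real q powr (w / 8)"
    "\<forall>\<^sub>F q::nat in sequentially. ln (ln (real q)) \<ge> 1"
    unfolding z_def using k w by real_asymp+
  have "\<forall>\<^sub>F q in sequentially. \<exists>S. finite S \<and> S \<subseteq> {p. prime p \<and> p \<le> poly_length s q} \<and>
           real (card S) \<le> k * ln (real q) \<and>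
           (\<Sum>p\<in>S. ln (real p) * real p powr (-s)) \<ge>
             w / 1280 * (ln (real q) powr (1 - s) * ln (ln (real q)) powr (1 - s))"
    using ev
  proof eventually_elim
    case (elim q)
    define l where "l = ln (real q)"
    define z' where "z' = z q"
    have z': "z' = 16 * k * (l * ln l)" by (simp add: z'_def z_def l_def)
    have l: "ln l \<ge> 1" "k * l \<ge> 10" using elim by (auto simp: l_def)
    have lnl: "ln l > 0" using l by linarith
    have zz: "z' \<ge> 100" "ln z' \<ge> ln l / 2" "ln z' \<le> 2 * ln l"
      using elim(1-3) unfolding z'_def l_def by blast+
    have lnz: "ln z' > 0" using zz lnl by linarith
    have l0: "l > 0" using zero_less_mult_pos[of k l] l(2) k by linarith
    let ?P = "{p. prime p \<and> real p \<le> z'}"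
    have fin: "finite ?P"
      by (rule finite_subset[of _ "{..nat \<lfloor>z'\<rfloor>}"]) (auto intro: le_nat_floor)
    have "2 * (k * l) \<le> z' / (4 * (2 * ln l))" unfolding z' using lnl by simp
    also have "\<dots> \<le> z' / (4 * ln z')"
      using zz lnz lnl by (intro divide_left_mono mult_left_mono mult_pos_pos) linarith+
    also have "\<dots> \<le> real (card ?P)" using zz(1) by (intro card_primes_ge) linarith
    \<comment> \<open>Primes below 9 are discarded to stay where
      \<open>ln_times_powr_decreasing\<close> applies; the surplus \<open>k * l \<ge> 10\<close>
      pays for them.\<close>
    also have "\<dots> \<le> real (card (?P - {..<9}) + 9)"
    proof -
      have "card ?P \<le> card (?P - {..<9} \<union> {..<9})" using fin by (intro card_mono) auto
      also have "\<dots> \<le> card (?P - {..<9}) + card {..<9::nat}" by (rule card_Un_le)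
      finally show ?thesis by simp
    qed
    finally have "k * l \<le> real (card (?P - {..<9}))" using l by simp
    hence "nat \<lfloor>k * l\<rfloor> \<le> card (?P - {..<9})" by linarith
    then obtain S where S: "S \<subseteq> ?P - {..<9}" "card S = nat \<lfloor>k * l\<rfloor>" "finite S"
      using obtain_subset_with_card_n by blast
    have card: "real (card S) \<le> k * l" "k * l / 2 \<le> real (card S)"
      using nat_floor_bounds[of "k * l"] l unfolding S(2) by linarith+
    have "z' + 1 \<le> real q powr (w / 8)" using elim by (simp add: z'_def)
    moreover have "real q powr (w / 8) \<le> real (poly_length s q) + 1"
      unfolding poly_length_def w_def by (rule nat_floor_bounds) simp
    ultimately have "z' \<le> real (poly_length s q)" by linarith
    have sub: "S \<subseteq> {p. prime p \<and> p \<le> poly_length s q}"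
    proof
      fix p assume "p \<in> S"
      hence p: "prime p" "real p \<le> z'" using S(1) by auto
      from p(2) have "real p \<le> real (poly_length s q)" using \<open>z' \<le> real (poly_length s q)\<close> by (rule order_trans)
      thus "p \<in> {p. prime p \<and> p \<le> poly_length s q}" using p(1) by simp
    qed
    \<comment> \<open>The base \<open>w / 20\<close> is below 1 and the exponent
      \<open>2 * (1 - s)\<close> is below 1.\<close>
    have k_powr: "w / 20 \<le> k powr (1 - s)"
    proof -
      have "w / 20 = (w / 20) powr 1" using w by simp
      also have "\<dots> \<le> (w / 20) powr (2 * (1 - s))" using w s by (intro powr_mono') auto
      also have "\<dots> = ((w / 20) powr 2) powr (1 - s)" unfolding powr_powr ..
      also have "(w / 20) powr 2 = k" using w by (simp add: k_def)
      finally show ?thesis .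
    qed
    \<comment> \<open>Here \<open>1280 = 4 * 16 * 20\<close>: 4 from the two halves in
      \<open>k * l / 2\<close> and \<open>ln l / 2\<close>, 16 from \<open>16 powr (-s)\<close>, and
      20 from \<open>k\<close>.\<close>
    have "w / 1280 * (l powr (1 - s) * ln l powr (1 - s)) = (1 / 4) * (1 / 16) * ((w / 20) * (l * ln l) powr (1 - s))"
      using l l0 by (simp add: powr_mult)
    also have "\<dots> \<le> (1 / 4) * 16 powr (-s) * (k powr (1 - s) * (l * ln l) powr (1 - s))"
    proof (intro mult_mono mult_left_mono order_refl k_powr)
      have "(16::real) powr (-1) \<le> 16 powr (-s)" using s by (intro powr_mono) auto
      thus "1 / 16 \<le> (16::real) powr (-s)" by (simp add: powr_minus_divide)
    qed (use w in auto)
    also have "\<dots> = (1 / 4) * (k * (l * ln l)) * z' powr (-s)"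
    proof -
      define u where "u = k * (l * ln l)"
      have u: "u > 0" unfolding u_def using k l0 lnl by (intro mult_pos_pos)
      have "k powr (1 - s) * (l * ln l) powr (1 - s) = u powr (1 + - s)"
        using k l0 lnl by (simp add: u_def powr_mult)
      also have "\<dots> = u * u powr (-s)"
        using u unfolding powr_add by simp
      moreover have "z' powr (-s) = 16 powr (-s) * u powr (-s)"
        using u by (simp add: z' u_def powr_mult mult.assoc)
      ultimately show ?thesis unfolding u_def by simp
    qed
    also have "\<dots> = (k * l / 2) * ((ln l / 2) * z' powr (-s))" by simp
    also have "\<dots> \<le> real (card S) * (ln z' * z' powr (-s))"
      using card zz(2) lnl l by (intro mult_mono mult_right_mono) simp_all
    also have "\<dots> = (\<Sum>p\<in>S. ln z' * z' powr (-s))" by simp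
    also have "\<dots> \<le> (\<Sum>p\<in>S. ln (real p) * real p powr (-s))"
    proof (rule sum_mono)
      fix p assume "p \<in> S"
      hence "9 \<le> real p" "real p \<le> z'" using S(1) by auto
      thus "ln z' * z' powr (-s) \<le> ln (real p) * real p powr (-s)"
        using s by (intro ln_times_powr_decreasing) auto
    qed
    finally have "w / 1280 * (l powr (1 - s) * ln l powr (1 - s)) \<le> (\<Sum>p\<in>S. ln (real p) * real p powr (-s))" .
    with S(3) sub card(1) show ?case unfolding l_def by (intro exI[of _ S] conjI)
  qed
  thus ?thesis unfolding k_def w_def .
qed

subsection \<open>Characters that are close to 1 on many primes\<close>

text \<open>Eight classes, whence the 8 in the pigeonhole count; points of the unit circle in one
  class are at most pi/4 apart.\<close>

definition octant :: "complex \<Rightarrow> bool \<times> bool \<times> bool" where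
  "octant z = (Re z \<ge> 0, Im z \<ge> 0, \<bar>Im z\<bar> \<le> \<bar>Re z\<bar>)"

text \<open>The same coordinate dominates in both points, so it has square at least 1/2 and equal
  signs in both. Its product is then at least 1/2, and the product of the other coordinates is
  nonnegative.\<close>

lemma Re_mult_cnj_same_octant:
  assumes "norm z = 1" "norm z' = 1" "octant z = octant z'"
  shows   "Re (z * cnj z') \<ge> 1 / 2"
proof -
  have half: "a * b \<ge> 1 / 2" if "a\<^sup>2 \<ge> 1 / 2" "b\<^sup>2 \<ge> 1 / 2" "a * b \<ge> 0" for a b :: real
  proof -
    have "(1 / 2) * (1 / 2) \<le> a\<^sup>2 * b\<^sup>2" using that by (intro mult_mono) auto
    hence "(1 / 2)\<^sup>2 \<le> (a * b)\<^sup>2" by (simp add: power2_eq_square mult_ac)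
    thus ?thesis using that(3) by (rule power2_le_imp_le)
  qed
  have norm_sq: "(Re z)\<^sup>2 + (Im z)\<^sup>2 = 1" "(Re z')\<^sup>2 + (Im z')\<^sup>2 = 1"
    using assms by (simp_all flip: cmod_power2)
  have pos: "Re z * Re z' \<ge> 0" "Im z * Im z' \<ge> 0"
    using assms(3) by (auto simp: octant_def zero_le_mult_iff)
  have eq: "Re (z * cnj z') = Re z * Re z' + Im z * Im z'" by simp
  show ?thesis
  proof (cases "\<bar>Im z\<bar> \<le> \<bar>Re z\<bar>")
    case True
    hence "(Im z)\<^sup>2 \<le> (Re z)\<^sup>2" "(Im z')\<^sup>2 \<le> (Re z')\<^sup>2"
      using assms(3) unfolding abs_le_square_iff [symmetric] by (auto simp: octant_def)
    hence "Re z * Re z' \<ge> 1 / 2" using norm_sq pos by (intro half) linarith+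
    thus ?thesis unfolding eq using pos by linarith
  next
    case False
    hence "\<bar>Re z\<bar> \<le> \<bar>Im z\<bar>" "\<bar>Re z'\<bar> \<le> \<bar>Im z'\<bar>"
      using assms(3) by (auto simp: octant_def)
    hence "(Re z)\<^sup>2 \<le> (Im z)\<^sup>2" "(Re z')\<^sup>2 \<le> (Im z')\<^sup>2"
      unfolding abs_le_square_iff [symmetric] .
    hence "Im z * Im z' \<ge> 1 / 2" using norm_sq pos by (intro half) linarith+
    thus ?thesis unfolding eq using pos by linarith
  qed
qed

text \<open>Pigeonhole on the \<open>8 ^ card S\<close> patterns of octants over \<open>S\<close>;
  \<open>B\<close> is the largest fibre's lower bound made concrete, namely a fibre of at least
  average size.\<close>

lemma many_chars_same_octants:
  assumes q: "prime q" and S: "finite S" "\<And>p. p \<in> S \<Longrightarrow> coprime p q"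
  obtains B where "B \<subseteq> {chi. dirichlet_char q chi}" "real (q - 1) \<le> real (card B) * 8 ^ card S"
    "\<And>chi psi p. chi \<in> B \<Longrightarrow> psi \<in> B \<Longrightarrow> p \<in> S \<Longrightarrow> Re (chi p * cnj (psi p)) \<ge> 1 / 2"
proof -
  let ?X = "{chi. dirichlet_char q chi}"
  let ?T = "PiE S (\<lambda>_. UNIV :: (bool \<times> bool \<times> bool) set)"
  define f where "f chi = restrict (\<lambda>p. octant (chi p)) S" for chi :: "nat \<Rightarrow> complex"
  have q0: "q > 0" using prime_gt_0_nat[OF q] .
  have "f \<in> ?X \<rightarrow> ?T" by (auto simp: f_def)
  moreover have "finite ?T" using S(1) by (intro finite_PiE) auto
  moreover have "?T \<noteq> {}" by (simp add: PiE_eq_empty_iff)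
  ultimately obtain t where t: "card (f -` {t} \<inter> ?X) * card ?T \<ge> card ?X"
    using pigeonhole_card[of f ?X ?T] finite_dirichlet_chars[OF q] by blast
  have "card (UNIV :: (bool \<times> bool \<times> bool) set) = 8"
    by (simp flip: UNIV_Times_UNIV add: card_cartesian_product)
  hence T: "card ?T = 8 ^ card S" using S(1) by (simp add: card_PiE)
  show ?thesis
  proof (rule that[of "f -` {t} \<inter> ?X"])
    have "real (card ?X) \<le> real (card (f -` {t} \<inter> ?X) * card ?T)" using t by (simp only: of_nat_le_iff)
    thus "real (q - 1) \<le> real (card (f -` {t} \<inter> ?X)) * 8 ^ card S"
      unfolding T card_dirichlet_chars[OF q] by simp
    fix chi psi p assume chi: "chi \<in> f -` {t} \<inter> ?X" and psi: "psi \<in> f -` {t} \<inter> ?X" and p: "p \<in> S"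
    have "f chi p = f psi p" using chi psi by simp
    hence "octant (chi p) = octant (psi p)" using p by (simp add: f_def)
    moreover have "norm (chi p) = 1" "norm (psi p) = 1"
      using chi psi S(2)[OF p] q0 by (auto intro!: norm_dirichlet_char)
    ultimately show "Re (chi p * cnj (psi p)) \<ge> 1 / 2" by (intro Re_mult_cnj_same_octant)
  qed auto
qed

text \<open>Ensures that for fixed \<open>chi\<close> each exceptional character arises at most once
  as a quotient.\<close>

lemma inj_on_char_mult_cnj:
  assumes "dirichlet_char q chi" "q > 0"
  shows   "inj_on (\<lambda>psi n. chi n * cnj (psi n)) {psi. dirichlet_char q psi}"
proof (rule inj_onI, rule ext)
  fix psi psi' n
  assume *: "psi \<in> {psi. dirichlet_char q psi}" "psi' \<in> {psi. dirichlet_char q psi}"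
    "(\<lambda>n. chi n * cnj (psi n)) = (\<lambda>n. chi n * cnj (psi' n))"
  show "psi n = psi' n"
  proof (cases "coprime n q")
    case True
    hence "chi n \<noteq> 0" using dirichlet_char_eq_0_iff[OF assms(1)] by simp
    thus ?thesis using fun_cong[OF *(3), of n] by simp
  next
    case False
    thus ?thesis using * dirichlet_char_eq_0_iff[of q psi n] dirichlet_char_eq_0_iff[of q psi' n] by simp
  qed
qed

lemma Re_sum_sum_mult_cnj:
  fixes f :: "'a \<Rightarrow> complex"
  shows "(\<Sum>x\<in>B. \<Sum>y\<in>B. Re (f x * cnj (f y))) = (norm (\<Sum>x\<in>B. f x))\<^sup>2"
proof -
  have "(\<Sum>x\<in>B. \<Sum>y\<in>B. Re (f x * cnj (f y))) = Re ((\<Sum>x\<in>B. f x) * cnj (\<Sum>x\<in>B. f x))"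
    unfolding cnj_sum sum_product Re_sum ..
  also have "\<dots> = (norm (\<Sum>x\<in>B. f x))\<^sup>2" unfolding complex_norm_square [symmetric] by simp
  finally show ?thesis .
qed

text \<open>
  Averaging over all quotients of characters in \<open>B\<close> gives every prime power a nonnegative weight,
  so the terms outside \<open>S\<close>, which are not controlled individually, can be dropped.
\<close>

lemma sum_Re_mangoldt_poly_quotients_ge:
  assumes B: "\<And>chi psi p. chi \<in> B \<Longrightarrow> psi \<in> B \<Longrightarrow> p \<in> S \<Longrightarrow> Re (chi p * cnj (psi p)) \<ge> 1 / 2"
    and S: "S \<subseteq> {p. prime p \<and> p \<le> y}"
  shows "(real (card B))\<^sup>2 * ((\<Sum>p\<in>S. ln (real p) * real p powr (-s)) / 2)
     \<le> (\<Sum>chi\<in>B. \<Sum>psi\<in>B. Re (mangoldt_poly s y (\<lambda>n. chi n * cnj (psi n))))"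
proof -
  define c where "c n = mangoldt n * real n powr (-s)" for n
  have c: "c n \<ge> 0" for n by (simp add: c_def mangoldt_nonneg)
  define G where "G n = (\<Sum>chi\<in>B. \<Sum>psi\<in>B. Re (chi n * cnj (psi n)))" for n :: nat
  have G0: "G n \<ge> 0" for n unfolding G_def Re_sum_sum_mult_cnj[of "\<lambda>chi. chi n"] by simp
  have GS: "G p \<ge> (real (card B))\<^sup>2 / 2" if "p \<in> S" for p
  proof -
    have "(real (card B))\<^sup>2 / 2 = (\<Sum>chi\<in>B. \<Sum>psi\<in>B. 1 / 2)" by (simp add: power2_eq_square)
    also have "\<dots> \<le> G p" unfolding G_def by (intro sum_mono B that)
    finally show ?thesis .
  qed
  have "(\<Sum>chi\<in>B. \<Sum>psi\<in>B. Re (mangoldt_poly s y (\<lambda>n. chi n * cnj (psi n))))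
     = (\<Sum>chi\<in>B. \<Sum>psi\<in>B. \<Sum>n\<in>{1..y}. c n * Re (chi n * cnj (psi n)))"
  proof (intro sum.cong refl)
    fix chi psi :: "nat \<Rightarrow> complex"
    have "Re (of_real r * z) = r * Re z" for r z by simp
    thus "Re (mangoldt_poly s y (\<lambda>n. chi n * cnj (psi n))) = (\<Sum>n\<in>{1..y}. c n * Re (chi n * cnj (psi n)))"
      unfolding mangoldt_poly_def Re_sum c_def by (simp only:)
  qed
  also have "\<dots> = (\<Sum>chi\<in>B. \<Sum>n\<in>{1..y}. \<Sum>psi\<in>B. c n * Re (chi n * cnj (psi n)))"
    by (rule sum.cong[OF refl], rule sum.swap)
  also have "\<dots> = (\<Sum>n\<in>{1..y}. \<Sum>chi\<in>B. \<Sum>psi\<in>B. c n * Re (chi n * cnj (psi n)))"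
    by (rule sum.swap)
  also have "\<dots> = (\<Sum>n\<in>{1..y}. c n * G n)"
    unfolding G_def sum_distrib_left ..
  also have "\<dots> \<ge> (\<Sum>n\<in>S. c n * G n)"
    using S c G0 by (intro sum_mono2) (auto intro: prime_ge_Suc_0_nat simp: Suc_le_eq prime_gt_0_nat)
  also have "(\<Sum>n\<in>S. c n * G n) \<ge> (\<Sum>n\<in>S. c n * ((real (card B))\<^sup>2 / 2))"
    by (intro sum_mono mult_left_mono GS c)
  also have "(\<Sum>n\<in>S. c n * ((real (card B))\<^sup>2 / 2)) = (\<Sum>p\<in>S. ln (real p) * real p powr (-s) * ((real (card B))\<^sup>2 / 2))"
    using S by (intro sum.cong refl) (auto simp: c_def)
  also have "\<dots> = (real (card B))\<^sup>2 * ((\<Sum>p\<in>S. ln (real p) * real p powr (-s)) / 2)"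
    by (simp add: sum_distrib_right sum_distrib_left sum_divide_distrib mult_ac)
  finally show ?thesis by simp
qed

text \<open>For unexceptional quotients the real part of the polynomial is within 1 of
  \<open>- Re (log_deriv_L chi s)\<close>. For fixed \<open>chi\<close> the quotients are distinct,
  so the exceptional sum enters once per \<open>chi\<close>, that is, \<open>card B\<close> times
  instead of \<open>card B ^ 2\<close> times.\<close>

lemma sum_Re_mangoldt_poly_quotients_le:
  assumes q: "prime q" and B: "B \<subseteq> {chi. dirichlet_char q chi}" and V: "V \<ge> 0"
    and upper: "\<And>chi. chi \<in> nonprincipal_chars q \<Longrightarrow> - Re (log_deriv_L chi (of_real s)) \<le> V"
  defines "P \<equiv> mangoldt_poly s (poly_length s q)"
  shows "(\<Sum>chi\<in>B. \<Sum>psi\<in>B. Re (P (\<lambda>n. chi n * cnj (psi n))))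
     \<le> (real (card B))\<^sup>2 * (V + 1) + real (card B) * (\<Sum>chi\<in>insert (principal_char q) (bad_chars s q). norm (P chi))"
proof -
  define E where "E = insert (principal_char q) (bad_chars s q)"
  have finB: "finite B" using finite_subset[OF B finite_dirichlet_chars[OF q]] .
  have finE: "finite E"
    using finite_subset[OF _ finite_nonprincipal_chars[OF q], of "bad_chars s q"] by (auto simp: bad_chars_def E_def)
  have q0: "q > 0" using prime_gt_0_nat[OF q] .
  have le: "Re (P chi) \<le> (V + 1) + (if chi \<in> E then norm (P chi) else 0)" if "dirichlet_char q chi" for chi
  proof (cases "chi \<in> E")
    case True
    thus ?thesis using complex_Re_le_cmod[of "P chi"] V by simp
  next
    case False
    hence chi: "chi \<in> nonprincipal_chars q" "chi \<notin> bad_chars s q"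
      using that by (auto simp: E_def nonprincipal_chars_def)
    hence "norm (log_deriv_L chi (of_real s) + P chi) \<le> 1" by (auto simp: bad_chars_def P_def not_less)
    hence "Re (log_deriv_L chi (of_real s) + P chi) \<le> 1" using complex_Re_le_cmod order_trans by blast
    thus ?thesis using upper[OF chi(1)] False by simp
  qed
  have inner: "(\<Sum>psi\<in>B. Re (P (\<lambda>n. chi n * cnj (psi n)))) \<le> real (card B) * (V + 1) + (\<Sum>chi\<in>E. norm (P chi))"
    if chi: "chi \<in> B" for chi
  proof -
    let ?h = "\<lambda>psi n. chi n * cnj (psi n)"
    have dc: "dirichlet_char q chi" using chi B by auto
    have inj: "inj_on ?h B" by (rule inj_on_subset[OF inj_on_char_mult_cnj[OF dc q0] B])
    have "(\<Sum>psi\<in>B. Re (P (?h psi))) \<le> (\<Sum>psi\<in>B. (V + 1) + (if ?h psi \<in> E then norm (P (?h psi)) else 0))"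
      using B by (intro sum_mono le dirichlet_char_mult_cnj dc) auto
    also have "\<dots> = real (card B) * (V + 1) + (\<Sum>psi\<in>B. if ?h psi \<in> E then norm (P (?h psi)) else 0)"
      by (simp add: sum.distrib)
    also have "(\<Sum>psi\<in>B. if ?h psi \<in> E then norm (P (?h psi)) else 0) = (\<Sum>chi\<in>?h ` B. if chi \<in> E then norm (P chi) else 0)"
      by (simp add: sum.reindex[OF inj])
    also have "\<dots> = (\<Sum>chi\<in>?h ` B \<inter> E. norm (P chi))"
      using finB by (simp add: sum.inter_restrict)
    also have "\<dots> \<le> (\<Sum>chi\<in>E. norm (P chi))"
      using finE by (intro sum_mono2) auto
    finally show ?thesis by simp
  qed
  have "(\<Sum>chi\<in>B. \<Sum>psi\<in>B. Re (P (\<lambda>n. chi n * cnj (psi n)))) \<le> (\<Sum>chi\<in>B. real (card B) * (V + 1) + (\<Sum>chi\<in>E. norm (P chi)))"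
    by (intro sum_mono inner)
  thus ?thesis by (simp add: E_def power2_eq_square algebra_simps)
qed

subsection \<open>Computability of the constant\<close>

lemma recursive_comp1:
  assumes "recursive 1 f" "recursive n g"
  shows   "recursive n (\<lambda>xs. f [g xs])"
  using recursive.comp[of "[g]" f n] assms by simp

lemma recursive_comp2:
  assumes "recursive 2 f" "recursive n g" "recursive n h"
  shows   "recursive n (\<lambda>xs. f [g xs, h xs])"
  using recursive.comp[of "[g, h]" f n] assms by (simp add: numeral_2_eq_2)

lemma recursive_Suc:
  assumes "recursive n f"
  shows   "recursive n (\<lambda>xs. Suc (f xs))"
  using recursive_comp1[OF recursive.succ assms] by simp

lemma recursive_pred: "recursive 1 (\<lambda>xs. xs ! 0 - 1)"
proof -
  \<comment> \<open>At \<open>Suc k\<close> the recursion returns the counter \<open>k\<close>,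
    which is the predecessor.\<close>
  have "recursive (Suc 0) (\<lambda>xs. rec_nat 0 (\<lambda>k r. (k # r # tl xs) ! 0) (hd xs))"
    by (rule recursive.prim_rec) (auto intro: recursive.zero recursive.proj)
  hence "recursive (Suc 0) (\<lambda>xs. xs ! 0 - 1)"
  proof (rule recursive.cong, intro allI impI)
    fix xs :: "nat list" assume "length xs = Suc 0"
    then obtain a where "xs = [a]" by (auto simp: length_Suc_conv)
    thus "xs ! 0 - 1 = rec_nat 0 (\<lambda>k r. (k # r # tl xs) ! 0) (hd xs)" by (cases a) auto
  qed
  thus ?thesis by simp
qed

lemma recursive_minus_const:
  assumes "recursive n f"
  shows   "recursive n (\<lambda>xs. f xs - c)"
proof (induction c)
  case (Suc c)
  show ?case using recursive_comp1[OF recursive_pred Suc] by simp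
qed (use assms in simp)

lemma recursive_minus:
  assumes "recursive n f" "recursive n g"
  shows   "recursive n (\<lambda>xs. f xs - g xs)"
proof -
  \<comment> \<open>Primitive recursion runs over the head of the list, so the subtrahend is put
    first and the predecessor is iterated.\<close>
  have "recursive (Suc 1) (\<lambda>xs. rec_nat ((\<lambda>ys. ys ! 0) (tl xs)) (\<lambda>k r. (\<lambda>ys. ys ! 1 - 1) (k # r # tl xs)) (hd xs))"
    by (rule recursive.prim_rec) (auto intro!: recursive.proj recursive_minus_const)
  hence "recursive 2 (\<lambda>xs. rec_nat (tl xs ! 0) (\<lambda>k r. r - 1) (hd xs))"
    by (simp add: numeral_2_eq_2)
  from recursive_comp2[OF this assms(2,1)]
  have "recursive n (\<lambda>xs. rec_nat (f xs) (\<lambda>k r. r - 1) (g xs))" by simp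
  moreover have "rec_nat a (\<lambda>k r. r - 1) b = a - b" for a b :: nat
    by (induction b) auto
  ultimately show ?thesis by simp
qed

text \<open>Iteration of a step that ignores the counter; index 1 is the position of the previous
  value in \<open>k # r # tl xs\<close>.\<close>

lemma recursive_rec_nat:
  assumes "recursive 2 (\<lambda>xs. h (xs ! 1))" "recursive n f"
  shows   "recursive n (\<lambda>xs. rec_nat c (\<lambda>_. h) (f xs))"
proof -
  have "recursive 0 (\<lambda>xs. c)"
    by (induction c) (auto intro: recursive.zero recursive_Suc)
  hence "recursive (Suc 0) (\<lambda>xs. rec_nat ((\<lambda>_. c) (tl xs)) (\<lambda>k r. (\<lambda>ys. h (ys ! 1)) (k # r # tl xs)) (hd xs))"
    using assms(1) by (intro recursive.prim_rec) (simp_all add: numeral_2_eq_2)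
  hence "recursive 1 (\<lambda>xs. rec_nat c (\<lambda>_. h) (hd xs))" by simp
  from recursive_comp1[OF this assms(2)] show ?thesis by simp
qed

lemma recursive_power2:
  assumes "recursive n f"
  shows   "recursive n (\<lambda>xs. 2 ^ f xs)"
proof -
  \<comment> \<open>Doubling is an iterated double successor, and powers of 2 are iterated
    doublings.\<close>
  have "rec_nat 0 (\<lambda>_ r. Suc (Suc r)) m = 2 * m" for m
    by (induction m) auto
  moreover have "recursive 2 (\<lambda>xs. rec_nat 0 (\<lambda>_ r. Suc (Suc r)) (xs ! 1))"
    by (intro recursive_rec_nat recursive_Suc recursive.proj) auto
  ultimately have "recursive 2 (\<lambda>xs. 2 * xs ! 1)" by simp
  hence "recursive n (\<lambda>xs. rec_nat 1 (\<lambda>_ r. 2 * r) (f xs))"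
    by (rule recursive_rec_nat[OF _ assms])
  moreover have "rec_nat (Suc 0) (\<lambda>_ r. 2 * r) m = 2 ^ m" for m :: nat
    by (induction m) auto
  ultimately show ?thesis by simp
qed

text \<open>Division by \<open>2 ^ 12\<close> gains 12 bits, so \<open>n - 12\<close> bits of the
  argument suffice. Subtracting 1/2 from \<open>i / 2 ^ (n - 12)\<close> removes
  \<open>2 ^ (n - 13)\<close> from the numerator, and the division by \<open>2 ^ 12\<close> turns
  the denominator into \<open>2 ^ n\<close>. Truncated subtraction is harmless because the true
  value is positive.\<close>

lemma effectively_computable_linear: "effectively_computable (\<lambda>x. (x - 1 / 2) / 2 ^ 12)"
  unfolding effectively_computable_def
proof (intro exI conjI allI ballI impI)
  let ?d = "\<lambda>xs :: nat list. xs ! 1 - 12" and ?g = "\<lambda>xs :: nat list. xs ! 2 - 2 ^ (xs ! 1 - 12 - 1)"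
  show "recursive 2 ?d"
    by (intro recursive_minus_const recursive.proj) simp
  show "recursive 3 ?g"
    by (intro recursive_minus recursive_power2 recursive_minus_const recursive.proj) simp_all
  fix k n i :: nat and x :: real
  assume "x \<in> {1 / 2 + 1 / 2 ^ k..1 - 1 / 2 ^ k}"
  hence "1 / 2 + 1 / 2 ^ k \<le> x" "x \<le> 1 - 1 / 2 ^ k" by simp_all
  moreover have "1 / 2 ^ k > (0::real)" by simp
  ultimately have x: "1 / 2 < x" "x < 1" by linarith+
  assume approx: "\<bar>x - real i / 2 ^ ?d [k, n]\<bar> \<le> 1 / 2 ^ ?d [k, n]"
  show "\<bar>(x - 1 / 2) / 2 ^ 12 - real (?g [k, n, i]) / 2 ^ n\<bar> \<le> 1 / 2 ^ n"
  \<comment> \<open>For \<open>n \<le> 12\<close> the exponents truncate to 0, so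
    \<open>i < 2\<close> and the output is \<open>i - 1 = 0\<close>; the true value is already below
    \<open>1 / 2 ^ n\<close>.\<close>
  proof (cases "n \<le> 12")
    case True
    hence "\<bar>x - real i\<bar> \<le> 1" using approx by simp
    hence "real i < 2" using x by linarith
    hence "?g [k, n, i] = 0" using True by simp
    moreover have "(2::real) ^ n \<le> 2 ^ 12" using True by (intro power_increasing) auto
    hence "1 / 2 ^ 12 \<le> 1 / (2::real) ^ n" by (intro divide_left_mono) auto
    moreover have "\<bar>(x - 1 / 2) / 2 ^ 12\<bar> \<le> 1 / 2 ^ 12" using x by (simp add: abs_le_iff)
    ultimately show ?thesis by (simp only: of_nat_0 div_0 diff_zero)
  next
    case False
    \<comment> \<open>Now \<open>n - 12 = Suc m\<close>, so the argument is given to within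
      \<open>1 / (2 * e)\<close> and the output is \<open>i - e\<close>, cut off at 0.\<close>
    then obtain m where m: "n = 12 + Suc m" using less_imp_add_positive[of 12 n] by (metis Suc_pred not_le)
    define e u where "e = (2::real) ^ m" and "u = 2 * e * x"
    have e: "e > 0" by (simp add: e_def)
    have g: "real (?g [k, n, i]) = max 0 (real i - e)"
      by (simp add: m e_def of_nat_diff max_def not_le flip: of_nat_less_iff)
    have "\<bar>x - real i / (2 * e)\<bar> \<le> 1 / (2 * e)" using approx by (simp add: m e_def)
    hence ui: "\<bar>u - real i\<bar> \<le> 1" using e by (simp add: u_def abs_le_iff field_simps)
    have "u > e" using x e by (simp add: u_def)
    hence "\<bar>(u - e) - max 0 (real i - e)\<bar> \<le> 1" using ui by linarith
    hence "\<bar>(u - e) - max 0 (real i - e)\<bar> / (4096 * (2 * e)) \<le> 1 / (4096 * (2 * e))"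
      using e by (intro divide_right_mono) auto
    also have "\<bar>(u - e) - max 0 (real i - e)\<bar> / (4096 * (2 * e)) = \<bar>((u - e) - max 0 (real i - e)) / (4096 * (2 * e))\<bar>"
      using e by simp
    also have "((u - e) - max 0 (real i - e)) / (4096 * (2 * e)) = (x - 1 / 2) / 2 ^ 12 - max 0 (real i - e) / (4096 * (2 * e))"
      using e by (simp add: u_def diff_divide_distrib)
    also have "4096 * (2 * e) = 2 ^ n" by (simp add: m e_def power_add)
    finally show ?thesis unfolding g .
  qed
qed

section \<open>Comparison of the lower and upper bounds for the averaged polynomial\<close>

theorem theorem6:
  "\<exists>C\<^sub>4 :: real \<Rightarrow> real. effectively_computable C\<^sub>4 \<and>
     (\<forall>\<sigma> \<in> {1 / 2 <..< 1}. C\<^sub>4 \<sigma> > 0 \<and>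
        (\<forall>\<^sub>F q :: nat in sequentially. prime q \<longrightarrow>
           (MAX chi \<in> nonprincipal_chars q. - Re (log_deriv_L chi (of_real \<sigma>)))
             \<ge> C\<^sub>4 \<sigma> * ln (real q) powr (1 - \<sigma>) * ln (ln (real q)) powr (1 - \<sigma>)))"
proof (intro exI[of _ "\<lambda>x. (x - 1 / 2) / 2 ^ 12"] conjI ballI)
  show "effectively_computable (\<lambda>x. (x - 1 / 2) / 2 ^ 12)"
    by (rule effectively_computable_linear)
  fix s :: real assume "s \<in> {1 / 2<..<1}"
  hence s: "1 / 2 < s" "s < 1" by auto
  thus "(s - 1 / 2) / 2 ^ 12 > 0" by simp
  define w where "w = 2 * s - 1"
  have w: "w > 0" "w < 1" "w\<^sup>2 > 0" using s by (auto simp: w_def)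
  obtain C where C: "\<forall>\<^sub>F q in sequentially. prime q \<longrightarrow>
           (\<Sum>chi\<in>insert (principal_char q) (bad_chars s q). norm (mangoldt_poly s (poly_length s q) chi))
              \<le> C * real q powr (1 - w\<^sup>2 / 64)"
    using sum_norm_mangoldt_poly_bad_chars_le[OF s] unfolding w_def by blast
  \<comment> \<open>Positivity of \<open>C'\<close> will make \<open>B\<close> nonempty, whatever
    the sign of \<open>C\<close>.\<close>
  define C' where "C' = \<bar>C\<bar> + 1"
  have C': "C' > 0" by (simp add: C'_def)
  define d where "d = w\<^sup>2"
  have d: "d > 0" using w by (simp add: d_def)
  have s': "1 - s > 0" using s by simp
  \<comment> \<open>The exponents add up to \<open>1 - d / 96\<close>. This will make
    \<open>B\<close> at least as large as the sum over exceptional characters.\<close>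
  have "\<forall>\<^sub>F q::nat in sequentially. C' * real q powr (1 - d / 64) * real q powr (d / 192) \<le> real q - 1"
    using d C' by real_asymp
  moreover have "\<forall>\<^sub>F q::nat in sequentially. w / 1280 * (ln (real q) powr (1 - s) * ln (ln (real q)) powr (1 - s)) \<ge> 8"
    using w s' by real_asymp
  ultimately show "\<forall>\<^sub>F q in sequentially. prime q \<longrightarrow>
           (s - 1 / 2) / 2 ^ 12 * ln (real q) powr (1 - s) * ln (ln (real q)) powr (1 - s)
           \<le> (MAX chi \<in> nonprincipal_chars q. - Re (log_deriv_L chi (of_real s)))"
    using C primes_with_large_sum[OF s] poly_length_less[OF s]
  proof eventually_elim
    case (elim q)
    show ?case
    proof
      assume q: "prime q"
      define F where "F = ln (real q) powr (1 - s) * ln (ln (real q)) powr (1 - s)"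
      define T where "T = (\<Sum>chi\<in>insert (principal_char q) (bad_chars s q). norm (mangoldt_poly s (poly_length s q) chi))"
      define V where "V = (MAX chi \<in> nonprincipal_chars q. - Re (log_deriv_L chi (of_real s)))"
      have F: "w / 1280 * F \<ge> 8" using elim(2) by (simp add: F_def)
      obtain S where S: "finite S" "S \<subseteq> {p. prime p \<and> p \<le> poly_length s q}"
        "real (card S) \<le> (w / 20)\<^sup>2 * ln (real q)"
        "(\<Sum>p\<in>S. ln (real p) * real p powr (-s)) \<ge> w / 1280 * F"
        using elim(4) unfolding w_def F_def by blast
      have q0: "real q > 0" using prime_gt_0_nat[OF q] by simp
      have coprime: "coprime p q" if "p \<in> S" for p
        using that S(2) elim(5) by (intro coprime_prime_modulus[OF q]) (auto simp: prime_gt_0_nat)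
      obtain B where B: "B \<subseteq> {chi. dirichlet_char q chi}" "real (q - 1) \<le> real (card B) * 8 ^ card S"
        "\<And>chi psi p. chi \<in> B \<Longrightarrow> psi \<in> B \<Longrightarrow> p \<in> S \<Longrightarrow> Re (chi p * cnj (psi p)) \<ge> 1 / 2"
        using many_chars_same_octants[OF q S(1) coprime] by metis
      have "(8::real) ^ card S = exp (real (card S) * ln 8)"
        by (subst exp_of_nat_mult) simp
      also have "\<dots> \<le> exp (d / 192 * ln (real q))"
      proof -
        \<comment> \<open>The numerical value is
          \<open>(1 / 400) * (25 / 12) = 1 / 192\<close>.\<close>
        have "ln (8::real) = 3 * ln 2" using ln_realpow[of 2 3] by simp
        hence "ln (8::real) \<le> 25 / 12" using ln2_le_25_over_36 by simp
        hence "real (card S) * ln 8 \<le> ((w / 20)\<^sup>2 * ln (real q)) * (25 / 12)"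
          by (intro mult_mono S(3)) (auto intro: order_trans[OF _ S(3)])
        thus ?thesis by (simp add: d_def power_divide mult.commute)
      qed
      also have "\<dots> = real q powr (d / 192)" using q0 by (simp add: powr_def)
      finally have "real (card B) * 8 ^ card S \<le> real (card B) * real q powr (d / 192)"
        by (intro mult_left_mono) auto
      with B(2) have "real q - 1 \<le> real (card B) * real q powr (d / 192)" using q0 by simp
      with elim(1) have "C' * real q powr (1 - d / 64) * real q powr (d / 192) \<le> real (card B) * real q powr (d / 192)"
        by linarith
      hence cardB: "C' * real q powr (1 - d / 64) \<le> real (card B)" using q0 by simp
      have "T \<le> C * real q powr (1 - d / 64)" using elim(3) q by (simp add: T_def d_def)
      also have "\<dots> \<le> C' * real q powr (1 - d / 64)" by (intro mult_right_mono) (auto simp: C'_def)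
      also note cardB
      finally have T: "T \<le> real (card B)" .
      have "0 < C' * real q powr (1 - d / 64)" using C' q0 by simp
      hence cardB0: "real (card B) > 0" using cardB by linarith
      \<comment> \<open>The sign of \<open>V\<close> is still unknown, while the upper estimate asks
        for a nonnegative bound; hence \<open>max V 0\<close>.\<close>
      have V_upper: "- Re (log_deriv_L chi (of_real s)) \<le> max V 0" if "chi \<in> nonprincipal_chars q" for chi
        unfolding V_def using that finite_nonprincipal_chars[OF q] by (intro max.coboundedI1 Max_ge) auto
      have "(real (card B))\<^sup>2 * ((w / 1280 * F) / 2) \<le> (real (card B))\<^sup>2 * ((\<Sum>p\<in>S. ln (real p) * real p powr (-s)) / 2)"
        using S(4) by (intro mult_left_mono divide_right_mono) auto
      also have "\<dots> \<le> (\<Sum>chi\<in>B. \<Sum>psi\<in>B. Re (mangoldt_poly s (poly_length s q) (\<lambda>n. chi n * cnj (psi n))))"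
        using B(3) S(2) by (intro sum_Re_mangoldt_poly_quotients_ge)
      also have "\<dots> \<le> (real (card B))\<^sup>2 * (max V 0 + 1) + real (card B) * T"
        unfolding T_def by (rule sum_Re_mangoldt_poly_quotients_le[OF q B(1) _ V_upper]) auto
      also have "\<dots> \<le> (real (card B))\<^sup>2 * (max V 0 + 1) + real (card B) * real (card B)"
        by (intro add_left_mono mult_left_mono T) auto
      also have "\<dots> = (real (card B))\<^sup>2 * (max V 0 + 2)" by (simp add: power2_eq_square algebra_simps)
      finally have "(w / 1280 * F) / 2 \<le> max V 0 + 2" using cardB0 by simp
      \<comment> \<open>Writing \<open>a = w / 1280 * F \<ge> 8\<close>, the previous line gives
        \<open>max V 0 \<ge> a / 2 - 2 \<ge> a / 4 > 0\<close>, so the maximum is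
        \<open>V\<close>.\<close>
      hence "V \<ge> (w / 1280 * F) / 4" using F by (simp add: max_def split: if_splits)
      \<comment> \<open>The left constant is \<open>w / 8192\<close>; a power of 2 in the
        denominator keeps the computation of the constant dyadic.\<close>
      moreover have "(s - 1 / 2) / 2 ^ 12 * F \<le> (w / 1280 * F) / 4"
      proof -
        have "F \<ge> 0" by (simp add: F_def)
        hence "(s - 1 / 2) / 2 ^ 12 * F \<le> (w / 5120) * F" using s by (intro mult_right_mono) (simp_all add: w_def)
        thus ?thesis by simp
      qed
      ultimately show "(s - 1 / 2) / 2 ^ 12 * ln (real q) powr (1 - s) * ln (ln (real q)) powr (1 - s)
           \<le> (MAX chi \<in> nonprincipal_chars q. - Re (log_deriv_L chi (of_real s)))"
        unfolding V_def F_def by (simp add: mult.assoc)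
    qed
  qed
qed

end
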